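(* For every Borel set $B\subseteq(0;1)$ there is a solid closed set $A\subseteq 2^\omega$, and also a solid open set $A\subseteq 2^\omega$, such that $\operatorname{ran}\mathcal{D}_A=\{0,1\}\cup B$ and $A\in\mathrm{Rng}_{\mathrm{inj}}$, i.e. for all $z_1,z_2\in 2^\omega$, if $\mathcal{D}_A(z_1)=\mathcal{D}_A(z_2)\in(0;1)$ then $z_1=z_2$.
   Context: $2^{\omega}$ is the Cantor space with the product topology; for a finite binary sequence $s$ let $N_s=\{x\in 2^\omega: s\subset x\}$. $\mu$ is the coin-tossing probability measure on $2^\omega$, with $\mu(N_s)=2^{-\mathrm{lh}(s)}$. For measurable $A\subseteq 2^\omega$ and $z\in 2^\omega$, $\mathcal{D}_A(z)=\lim_{n\to\infty}\mu(A\cap N_{z\restriction n})/\mu(N_{z\restriction n})$, defined only when the limit exists; $\operatorname{ran}\mathcal{D}_A$ is the set of values attained at points where it is defined. A point is blurry for $A$ if $\mathcal{D}_A$ is undefined there; $A$ is solid if it has no blurry points. *)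

theory Defs
  imports "HOL-Probability.Probability"
begin

definition cantor_top :: "(nat \<Rightarrow> bool) topology" where
  "cantor_top = product_topology (\<lambda>_. discrete_topology (UNIV :: bool set)) UNIV"

definition cantor_measure :: "(nat \<Rightarrow> bool) measure" where
  "cantor_measure = PiM UNIV (\<lambda>_::nat. measure_pmf (bernoulli_pmf (1/2)))"

definition cyl :: "(nat \<Rightarrow> bool) \<Rightarrow> nat \<Rightarrow> (nat \<Rightarrow> bool) set" where
  "cyl z n = {x. \<forall>i<n. x i = z i}"

definition dens_seq :: "(nat \<Rightarrow> bool) set \<Rightarrow> (nat \<Rightarrow> bool) \<Rightarrow> nat \<Rightarrow> real" where
  "dens_seq A z n = measure cantor_measure (A \<inter> cyl z n) / measure cantor_measure (cyl z n)"

text \<open>D_A(z) is defined and equals r.\<close>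

definition density_at :: "(nat \<Rightarrow> bool) set \<Rightarrow> (nat \<Rightarrow> bool) \<Rightarrow> real \<Rightarrow> bool" where
  "density_at A z r \<longleftrightarrow> dens_seq A z \<longlonglongrightarrow> r"

definition ran_density :: "(nat \<Rightarrow> bool) set \<Rightarrow> real set" where
  "ran_density A = {r. \<exists>z. density_at A z r}"

definition blurry :: "(nat \<Rightarrow> bool) set \<Rightarrow> (nat \<Rightarrow> bool) \<Rightarrow> bool" where
  "blurry A z \<longleftrightarrow> \<not> (\<exists>r. density_at A z r)"

definition solid :: "(nat \<Rightarrow> bool) set \<Rightarrow> bool" where
  "solid A \<longleftrightarrow> (\<forall>z. \<not> blurry A z)"

definition Rng_inj :: "(nat \<Rightarrow> bool) set \<Rightarrow> bool" where
  "Rng_inj A \<longleftrightarrow> (\<forall>z1 z2 r. density_at A z1 r \<and> density_at A z2 r \<and> r \<in> {0<..<1} \<longrightarrow> z1 = z2)"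

end

theory Submission
  imports Defs
begin

text \<open>
  As in the Lusin--Souslin theorem, \<open>B\<close> is a continuous injective image of a closed set \<open>F\<close> in
  Baire space; here the map sends \<open>y\<close> to the real whose binary digits are the parities of \<open>y\<close>.
  An automaton reading \<open>z\<close> bit by bit keeps a current density that is harmonic (the mean of its values
  at the two successor states); the open set of all \<open>z\<close> on which this value reaches 1 then has exactly
  these relative densities.

  The automaton guesses a point of \<open>F\<close>. At alternate steps it moves its density towards the value of the
  guess, the balance being diverted to the sibling node as a clopen set of dyadic density, and offers the
  choice of keeping the guess or switching to one that first differs from it at a prescribed coordinate and
  in a prescribed value. Each such pair is offered once between two switches, and a switch fixes all
  coordinates up to the one changed. Hence the guesses converge along every surviving branch,
  including those with only finitely many switches, and each point of \<open>F\<close> is the limit along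
  exactly one of them. On all other branches the density is eventually 0 or 1.

  The closed set is the complement of the open set obtained for \<open>{1 - r | r. r \<in> B}\<close>.
\<close>

subsection \<open>The coin-tossing measure\<close>

text \<open>Needed to identify the product sigma-algebra on \<open>nat \<Rightarrow> bool\<close>
  with the Borel one.\<close>

instance bool :: second_countable_topology
proof
  have "open = generate_topology (UNIV :: bool set set)"
    by (intro ext) (simp add: discrete_topology_class.open_discrete generate_topology.Basis)
  then show "\<exists>B :: bool set set. countable B \<and> open = generate_topology B"
    by (intro exI[of _ UNIV]) (simp add: countable_finite)
qed

lemma sets_cantor_measure: "sets cantor_measure = sets borel"
proof -
  have "sets (measure_pmf (bernoulli_pmf (1/2))) = sets (borel :: bool measure)"
  proof -
    have "X \<in> sets borel" for X :: "bool set"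
      by (rule borel_open) (rule discrete_topology_class.open_discrete)
    then show ?thesis by auto
  qed
  then have "sets cantor_measure = sets (PiM UNIV (\<lambda>_::nat. borel :: bool measure))"
    unfolding cantor_measure_def by (intro sets_PiM_cong) auto
  then show ?thesis
    by (simp add: sets_PiM_equal_borel)
qed

lemma cantor_top_eq_euclidean: "cantor_top = euclidean"
proof -
  have "discrete_topology (UNIV :: bool set) = euclidean"
    unfolding topology_eq open_openin[symmetric] openin_discrete_topology by (simp add: discrete_topology_class.open_discrete)
  then show ?thesis
    by (simp add: cantor_top_def euclidean_product_topology)
qed

lemma space_cantor_measure [simp]: "space cantor_measure = UNIV"
  by (simp add: cantor_measure_def space_PiM)

lemma prob_space_cantor_measure: "prob_space cantor_measure"
  unfolding cantor_measure_def by (intro prob_space_PiM measure_pmf.prob_space_axioms)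

lemma open_cyl: "open (cyl z n)"
proof -
  have "cyl z n = (\<Inter>i\<in>{..<n}. (\<lambda>x. x i) -` {z i})" by (auto simp: cyl_def)
  also have "open \<dots>"
    by (intro open_INT ballI finite_lessThan open_vimage discrete_topology_class.open_discrete continuous_on_product_coordinates)
  finally show ?thesis .
qed

text \<open>Prepending an independent fair bit preserves the coin-tossing measure
  (\<open>PiM_iter\<close>), so Fubini over that bit gives the self-similarity from which all later
  measures are computed.\<close>

lemma cantor_measure_split:
  assumes A: "A \<in> sets cantor_measure"
  shows "measure cantor_measure A =
    (measure cantor_measure {x. case_nat False x \<in> A} + measure cantor_measure {x. case_nat True x \<in> A}) / 2"
proof -
  let ?M = "measure_pmf (bernoulli_pmf (1/2))"
  interpret C: prob_space cantor_measure by (rule prob_space_cantor_measure)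
  interpret S: sequence_space ?M
    by unfold_locales
  let ?f = "\<lambda>(s::bool, w). case_nat s w :: nat \<Rightarrow> bool"
  have meas: "?f \<in> measurable (?M \<Otimes>\<^sub>M cantor_measure) cantor_measure"
    unfolding cantor_measure_def by measurable
  have "emeasure cantor_measure A = emeasure (distr (?M \<Otimes>\<^sub>M cantor_measure) cantor_measure ?f) A"
    using S.PiM_iter by (simp add: cantor_measure_def)
  also have "\<dots> = emeasure (?M \<Otimes>\<^sub>M cantor_measure) (?f -` A \<inter> space (?M \<Otimes>\<^sub>M cantor_measure))"
    using meas A by (rule emeasure_distr)
  also have "\<dots> = (\<integral>\<^sup>+s. emeasure cantor_measure (Pair s -` (?f -` A \<inter> space (?M \<Otimes>\<^sub>M cantor_measure))) \<partial>?M)"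
    using measurable_sets[OF meas A] by (rule C.emeasure_pair_measure_alt)
  also have "\<dots> = (\<integral>\<^sup>+s. emeasure cantor_measure {x. case_nat s x \<in> A} \<partial>?M)"
    by (intro nn_integral_cong arg_cong2[where f=emeasure]) (auto simp: space_pair_measure)
  also have "\<dots> = ennreal ((measure cantor_measure {x. case_nat False x \<in> A} + measure cantor_measure {x. case_nat True x \<in> A}) / 2)"
  proof -
    have half: "ennreal a * inverse 2 + ennreal b * inverse 2 = ennreal ((a + b) / 2)" if "0 \<le> a" "0 \<le> b" for a b
    proof -
      have "inverse 2 = ennreal (1/2)" using inverse_ennreal[of 2] by simp
      then have "ennreal a * inverse 2 = ennreal (a / 2)" "ennreal b * inverse 2 = ennreal (b / 2)"
        using that ennreal_mult[of a "1/2"] ennreal_mult[of b "1/2"] by simp_all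
      then show ?thesis using that ennreal_plus[of "a/2" "b/2"] by (simp add: add_divide_distrib)
    qed
    have "(\<integral>\<^sup>+s. emeasure cantor_measure {x. case_nat s x \<in> A} \<partial>?M) =
        emeasure cantor_measure {x. case_nat False x \<in> A} * inverse 2 +
        emeasure cantor_measure {x. case_nat True x \<in> A} * inverse 2"
      by (simp add: nn_integral_measure_pmf_finite UNIV_bool)
    then show ?thesis
      by (simp only: C.emeasure_eq_measure half measure_nonneg)
  qed
  finally show ?thesis
    unfolding C.emeasure_eq_measure by (subst (asm) ennreal_inj) auto
qed

lemma measure_Int_cyl_Suc:
  assumes A: "A \<in> sets cantor_measure"
  shows "measure cantor_measure (A \<inter> cyl z (Suc n)) =
    measure cantor_measure ({x. case_nat (z 0) x \<in> A} \<inter> cyl (z \<circ> Suc) n) / 2"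
proof -
  from open_cyl[of z "Suc n"] have "A \<inter> cyl z (Suc n) \<in> sets cantor_measure"
    using A by (auto simp: sets_cantor_measure)
  from cantor_measure_split[OF this]
  have "measure cantor_measure (A \<inter> cyl z (Suc n)) =
      (measure cantor_measure {x. case_nat False x \<in> A \<inter> cyl z (Suc n)} + 
       measure cantor_measure {x. case_nat True x \<in> A \<inter> cyl z (Suc n)}) / 2" .
  moreover have "{x. case_nat b x \<in> A \<inter> cyl z (Suc n)} =
      (if b = z 0 then {x. case_nat (z 0) x \<in> A} \<inter> cyl (z \<circ> Suc) n else {})" for b
    by (auto simp: cyl_def less_Suc_eq_0_disj split: nat.splits)
  ultimately show ?thesis
    by (cases "z 0") simp_all
qed

lemma measure_cyl: "measure cantor_measure (cyl z n) = 1 / 2 ^ n"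
proof (induction n arbitrary: z)
  case 0
  show ?case using prob_space.prob_space[OF prob_space_cantor_measure] by (simp add: cyl_def)
next
  case (Suc n)
  have "UNIV \<in> sets cantor_measure" by (metis sets.top space_cantor_measure)
  from measure_Int_cyl_Suc[OF this, of z n] Suc show ?case by simp
qed

section \<open>Cylinders as a base of the topology\<close>

lemma open_if_cyl_subset:
  assumes "\<And>z. z \<in> U \<Longrightarrow> \<exists>n. cyl z n \<subseteq> U"
  shows "open U"
proof (rule topological_space_class.openI)
  fix z assume "z \<in> U"
  then obtain n where "cyl z n \<subseteq> U" using assms by blast
  then show "\<exists>T. open T \<and> z \<in> T \<and> T \<subseteq> U"
    using open_cyl[of z n] by (auto simp: cyl_def)
qed

lemma open_contains_cyl:
  assumes "open U" "z \<in> U"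
  obtains n where "cyl z n \<subseteq> U"
proof -
  have "openin (product_topology (\<lambda>_. euclidean) UNIV) U"
    using assms by (simp add: euclidean_product_topology)
  from product_topology_open_contains_basis[OF this assms(2)]
  obtain X where X: "z \<in> (\<Pi>\<^sub>E i\<in>UNIV. X i)" "finite {i. X i \<noteq> UNIV}" "(\<Pi>\<^sub>E i\<in>UNIV. X i) \<subseteq> U"
    by auto
  obtain n where n: "{i. X i \<noteq> UNIV} \<subseteq> {..<n}"
    using finite_nat_iff_bounded X(2) by blast
  have "x i \<in> X i" if "x \<in> cyl z n" for x i
  proof (cases "i < n")
    case True
    then show ?thesis using that X(1) by (auto simp: cyl_def)
  next
    case False
    then show ?thesis using n by auto
  qed
  then have "cyl z n \<subseteq> U" using X(3) by (auto simp: PiE_iff)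
  then show thesis by (rule that)
qed

subsection \<open>Harmonic automata\<close>

fun run :: "('q \<Rightarrow> bool \<Rightarrow> 'q) \<Rightarrow> 'q \<Rightarrow> (nat \<Rightarrow> bool) \<Rightarrow> nat \<Rightarrow> 'q" where
  "run step q z 0 = q"
| "run step q z (Suc n) = step (run step q z n) (z n)"

lemma run_Suc_shift: "run step q z (Suc n) = run step (step q (z 0)) (z \<circ> Suc) n"
  by (induction n) auto

lemma run_cong: "(\<And>i. i < n \<Longrightarrow> z i = z' i) \<Longrightarrow> run step q z n = run step q z' n"
  by (induction n) auto

definition accepted :: "('q \<Rightarrow> bool \<Rightarrow> 'q) \<Rightarrow> ('q \<Rightarrow> real) \<Rightarrow> 'q \<Rightarrow> (nat \<Rightarrow> bool) set" where
  "accepted step dens q = {z. \<exists>n. dens (run step q z n) = 1}"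

lemma open_accepted: "open (accepted step dens q)"
proof (rule open_if_cyl_subset)
  fix z assume "z \<in> accepted step dens q"
  then obtain n where "dens (run step q z n) = 1" by (auto simp: accepted_def)
  moreover have "run step q x n = run step q z n" if "x \<in> cyl z n" for x
    using that by (intro run_cong) (auto simp: cyl_def)
  ultimately show "\<exists>n. cyl z n \<subseteq> accepted step dens q"
    by (auto simp: accepted_def intro!: exI[of _ n])
qed

text \<open>The weight is a Lyapunov function: it forces the probability of never reaching density 0 or 1 to be 0.\<close>

locale harmonic_automaton =
  fixes Q :: "'q set" and step :: "'q \<Rightarrow> bool \<Rightarrow> 'q" and dens :: "'q \<Rightarrow> real"
    and weight :: "'q \<Rightarrow> real" and rate :: real
  assumes step_closed: "q \<in> Q \<Longrightarrow> step q b \<in> Q"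
    and dens_range: "q \<in> Q \<Longrightarrow> 0 \<le> dens q \<and> dens q \<le> 1"
    and dens_mean: "q \<in> Q \<Longrightarrow> dens (step q False) + dens (step q True) = 2 * dens q"
    and weight_nonneg: "q \<in> Q \<Longrightarrow> 0 \<le> weight q"
    and weight_ge_1: "q \<in> Q \<Longrightarrow> dens q \<notin> {0, 1} \<Longrightarrow> 1 \<le> weight q"
    and weight_decay: "q \<in> Q \<Longrightarrow> weight (step q False) + weight (step q True) \<le> 2 * rate * weight q"
    and rate_range: "0 \<le> rate" "rate < 1"
begin

abbreviation acc where "acc \<equiv> accepted step dens"

lemma run_closed: "q \<in> Q \<Longrightarrow> run step q z n \<in> Q"
  by (induction n) (auto intro: step_closed)

text \<open>An endpoint of the unit interval is a mean of two of its points only trivially, so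
  densities 0 and 1 are absorbing.\<close>

lemma dens_step_extreme:
  assumes "q \<in> Q" "dens q \<in> {0, 1}"
  shows "dens (step q b) = dens q"
  using assms dens_mean[of q] dens_range[OF step_closed, of q False] dens_range[OF step_closed, of q True]
  by (cases b) auto

lemma dens_run_extreme:
  assumes "q \<in> Q" "dens q \<in> {0, 1}"
  shows "dens (run step q z n) = dens q"
proof (induction n)
  case (Suc n)
  then show ?case
    using dens_step_extreme[OF run_closed[OF assms(1)], of z n "z n"] assms(2) by simp
qed simp

lemma acc_step:
  assumes "q \<in> Q"
  shows "{x. case_nat b x \<in> acc q} = acc (step q b)"
proof (intro set_eqI iffI; clarsimp simp: accepted_def)
  fix x n assume n: "dens (run step q (case_nat b x) n) = 1"
  show "\<exists>n. dens (run step (step q b) x n) = 1"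
  proof (cases n)
    \<comment> \<open>Acceptance by \<open>q\<close> itself leaves no step to drop; absorption
      passes density 1 on to the successor.\<close>
    case 0
    with n dens_step_extreme[OF assms, of b] show ?thesis by (intro exI[of _ 0]) simp
  next
    case (Suc m)
    with n show ?thesis by (intro exI[of _ m]) (simp add: run_Suc_shift o_def del: run.simps)
  qed
next
  fix x n assume "dens (run step (step q b) x n) = 1"
  then show "\<exists>n. dens (run step q (case_nat b x) n) = 1"
    by (intro exI[of _ "Suc n"]) (simp add: run_Suc_shift o_def del: run.simps)
qed

lemma acc_in_sets: "acc q \<in> sets cantor_measure"
  by (simp add: sets_cantor_measure open_accepted)

text \<open>Acceptance probability and \<open>dens\<close> are both harmonic, so their gap at
  \<open>q\<close> is at most the mean gap at the successors. The weight dominates the gap, and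
  iterating contracts the bound by \<open>rate\<close> until the gap must vanish.\<close>

lemma measure_acc:
  assumes "q \<in> Q"
  shows "measure cantor_measure (acc q) = dens q"
proof -
  interpret prob_space cantor_measure by (rule prob_space_cantor_measure)
  have bound: "\<bar>prob (acc q) - dens q\<bar> \<le> rate ^ n * weight q" if "q \<in> Q" for n q
    using that
  proof (induction n arbitrary: q)
    case 0
    consider "dens q = 0" | "dens q = 1" | "dens q \<notin> {0,1}" by blast
    then show ?case
    proof cases
      case 1
      then have "acc q = {}"
        using dens_run_extreme[OF 0] by (auto simp: accepted_def)
      with 1 show ?thesis using weight_nonneg[OF 0] by simp
    next
      case 2
      then have "acc q = space cantor_measure"
        using dens_run_extreme[OF 0] by (auto simp: accepted_def)
      with 2 show ?thesis using weight_nonneg[OF 0] prob_space by simp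
    next
      case 3
      have "\<bar>prob (acc q) - dens q\<bar> \<le> 1"
        using dens_range[OF 0] prob_le_1[of "acc q"] measure_nonneg[of cantor_measure "acc q"] by linarith
      with weight_ge_1[OF 0 3] show ?thesis by simp
    qed
  next
    case (Suc n)
    have "prob (acc q) = (prob (acc (step q False)) + prob (acc (step q True))) / 2"
      using cantor_measure_split[OF acc_in_sets, of q] acc_step[OF Suc.prems] by simp
    moreover have "dens q = (dens (step q False) + dens (step q True)) / 2"
      using dens_mean[OF Suc.prems] by simp
    moreover note Suc.IH[OF step_closed[OF Suc.prems], of False] Suc.IH[OF step_closed[OF Suc.prems], of True]
    ultimately have "\<bar>prob (acc q) - dens q\<bar> \<le> rate ^ n * (weight (step q False) + weight (step q True)) / 2"
      by (simp add: algebra_simps) argo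
    also have "\<dots> \<le> rate ^ n * (2 * rate * weight q) / 2"
      using weight_decay[OF Suc.prems] rate_range by (intro divide_right_mono mult_left_mono) auto
    finally show ?case by (simp add: mult_ac)
  qed
  have "(\<lambda>n. rate ^ n * weight q) \<longlonglongrightarrow> 0 * weight q"
    using rate_range by (intro tendsto_intros LIMSEQ_power_zero) auto
  then have "\<bar>prob (acc q) - dens q\<bar> \<le> 0 * weight q"
    by (rule LIMSEQ_le_const) (use bound[OF assms] in blast)
  then show ?thesis by simp
qed

text \<open>Reading a bit turns a section of the accepted set into the set accepted from the
  successor, so after \<open>n\<close> bits the relative density is the measure accepted from the
  state reached.\<close>

lemma dens_seq_acc:
  assumes "q \<in> Q"
  shows "dens_seq (acc q) z n = dens (run step q z n)"
proof -
  interpret prob_space cantor_measure by (rule prob_space_cantor_measure)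
  have "prob (acc q \<inter> cyl z n) = dens (run step q z n) / 2 ^ n"
    using assms
  proof (induction n arbitrary: z q)
    case 0
    then show ?case by (simp add: cyl_def measure_acc)
  next
    case (Suc n)
    show ?case
      unfolding measure_Int_cyl_Suc[OF acc_in_sets] acc_step[OF Suc.prems] Suc.IH[OF step_closed[OF Suc.prems]]
        run_Suc_shift by simp
  qed
  then show ?thesis by (simp add: dens_seq_def measure_cyl)
qed

end

subsection \<open>Binary expansions\<close>

definition bin_val :: "(nat \<Rightarrow> bool) \<Rightarrow> real" where
  "bin_val z = (\<Sum>k. of_bool (z k) / 2 ^ Suc k)"

lemma sums_half_powers: "(\<lambda>k. 1 / 2 ^ Suc k :: real) sums 1"
  using power_half_series by (simp add: power_divide)

lemma summable_bin_val: "summable (\<lambda>k. of_bool (z k) / 2 ^ Suc k :: real)"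
  by (rule summable_comparison_test'[OF sums_summable[OF sums_half_powers], of 0]) auto

lemma bin_val_rec: "bin_val z = (of_bool (z 0) + bin_val (z \<circ> Suc)) / 2"
proof -
  have "(\<Sum>k. of_bool (z (Suc k)) / 2 ^ Suc (Suc k)) = bin_val z - of_bool (z 0) / 2"
    using suminf_split_head[OF summable_bin_val[of z]] by (simp add: bin_val_def)
  moreover have "(\<Sum>k. of_bool (z (Suc k)) / 2 ^ Suc (Suc k)) = bin_val (z \<circ> Suc) / 2"
    using suminf_divide[OF summable_bin_val[of "z \<circ> Suc"], of 2] by (simp add: bin_val_def mult_ac)
  ultimately show ?thesis by (simp add: add_divide_distrib)
qed

lemma bin_val_range: "0 \<le> bin_val z" "bin_val z \<le> 1"
proof -
  show "0 \<le> bin_val z"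
    unfolding bin_val_def by (intro suminf_nonneg summable_bin_val) auto
  have "bin_val z \<le> (\<Sum>k. 1 / 2 ^ Suc k)"
    unfolding bin_val_def
    by (intro suminf_le summable_bin_val sums_summable[OF sums_half_powers]) (auto simp: divide_right_mono)
  then show "bin_val z \<le> 1" using sums_unique[OF sums_half_powers] by simp
qed

lemma bin_val_less_1: "\<not> z k \<Longrightarrow> bin_val z < 1"
proof (induction k arbitrary: z)
  case 0
  then show ?case using bin_val_rec[of z] bin_val_range[of "z \<circ> Suc"] by simp
next
  case (Suc k)
  then have "bin_val (z \<circ> Suc) < 1" by simp
  then show ?case using bin_val_rec[of z] by (cases "z 0") auto
qed

text \<open>Without a tail of ones every shifted expansion has value below 1, so the first digit
  says whether the value is at least 1/2; digit and tail value are then both determined.\<close>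

lemma bin_val_inj:
  assumes "\<exists>\<^sub>\<infinity>k. \<not> z k" "\<exists>\<^sub>\<infinity>k. \<not> z' k" "bin_val z = bin_val z'"
  shows "z = z'"
proof
  have tail: "\<exists>\<^sub>\<infinity>k. \<not> (x \<circ> Suc) k" if x: "\<exists>\<^sub>\<infinity>k. \<not> x k" for x :: "nat \<Rightarrow> bool"
    unfolding INFM_nat
  proof
    fix m
    obtain n where "n > Suc m" "\<not> x n" using x by (auto simp: INFM_nat)
    then show "\<exists>n>m. \<not> (x \<circ> Suc) n" by (intro exI[of _ "n - 1"]) auto
  qed
  have tail_less_1: "bin_val (x \<circ> Suc) < 1" if x: "\<exists>\<^sub>\<infinity>k. \<not> x k" for x :: "nat \<Rightarrow> bool"
  proof -
    obtain k where "\<not> (x \<circ> Suc) k" using INFM_EX[OF tail[OF x]] by blast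
    then show ?thesis by (rule bin_val_less_1)
  qed
  fix k
  show "z k = z' k"
    using assms
  proof (induction k arbitrary: z z')
    case inf: 0
    have "bin_val (z \<circ> Suc) < 1" "bin_val (z' \<circ> Suc) < 1"
      using inf(1,2) by (simp_all only: tail_less_1)
    then show ?case
      using inf(3) bin_val_rec[of z] bin_val_rec[of z'] bin_val_range[of "z \<circ> Suc"] bin_val_range[of "z' \<circ> Suc"]
      by (cases "z 0"; cases "z' 0") auto
  next
    case (Suc k)
    have "bin_val (z \<circ> Suc) < 1" "bin_val (z' \<circ> Suc) < 1"
      using Suc.prems(1,2) by (simp_all only: tail_less_1)
    then have "bin_val (z \<circ> Suc) = bin_val (z' \<circ> Suc)"
      using Suc.prems(3) bin_val_rec[of z] bin_val_rec[of z'] bin_val_range[of "z \<circ> Suc"] bin_val_range[of "z' \<circ> Suc"]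
      by (cases "z 0"; cases "z' 0") auto
    from Suc.IH[OF tail[OF Suc.prems(1)] tail[OF Suc.prems(2)] this] show ?case by simp
  qed
qed

lemma bin_val_split: "bin_val z = (\<Sum>k<n. of_bool (z k) / 2 ^ Suc k) + bin_val (\<lambda>k. z (k + n)) / 2 ^ n"
proof (induction n)
  case (Suc n)
  then show ?case
    using bin_val_rec[of "\<lambda>k. z (k + n)"] by (simp add: o_def add_divide_distrib)
qed simp

lemma bin_val_surj:
  assumes "0 \<le> r" "r < 1"
  obtains z where "\<exists>\<^sub>\<infinity>k. \<not> z k" "bin_val z = r"
proof -
  \<comment> \<open>\<open>rem\<close> is the orbit of \<open>r\<close> under the doubling map; the
    digits record when it lies in the upper half.\<close>
  define rem where "rem = rec_nat r (\<lambda>_ x. 2 * x - of_bool (1/2 \<le> x))"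
  define z where "z k \<longleftrightarrow> 1/2 \<le> rem k" for k
  have rem_Suc: "rem (Suc n) = 2 * rem n - of_bool (z n)" for n
    by (simp add: rem_def z_def)
  have rem_range: "0 \<le> rem n \<and> rem n < 1" for n
  proof (induction n)
    case (Suc n)
    then show ?case unfolding rem_Suc by (auto simp: z_def)
  qed (use assms in \<open>simp add: rem_def\<close>)
  have bin_val_rem: "bin_val (\<lambda>k. z (k + m)) = rem m" for m
  proof -
    have split: "rem m = (\<Sum>k<n. of_bool (z (k + m)) / 2 ^ Suc k) + rem (n + m) / 2 ^ n" for n
    proof (induction n)
      case (Suc n)
      then show ?case by (simp add: rem_Suc diff_divide_distrib)
    qed simp
    have "(\<lambda>n. rem (n + m) * (1/2) ^ n) \<longlonglongrightarrow> 0"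
    proof (rule Lim_null_comparison)
      show "(\<lambda>n. (1/2) ^ n :: real) \<longlonglongrightarrow> 0" by (intro LIMSEQ_power_zero) auto
      show "\<forall>\<^sub>F n in sequentially. norm (rem (n + m) * (1/2) ^ n) \<le> (1/2) ^ n"
        using rem_range by (intro always_eventually allI) (simp add: abs_mult mult_left_le_one_le less_imp_le)
    qed
    then have "(\<lambda>n. rem m - rem (n + m) * (1/2) ^ n) \<longlonglongrightarrow> rem m - 0"
      by (intro tendsto_intros)
    moreover have "rem m - rem (n + m) * (1/2) ^ n = (\<Sum>k<n. of_bool (z (k + m)) / 2 ^ Suc k)" for n
      using split[of n] by (simp add: power_divide)
    ultimately have "(\<lambda>k. of_bool (z (k + m)) / 2 ^ Suc k) sums rem m"
      by (simp add: sums_def)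
    then show ?thesis by (simp add: bin_val_def sums_iff)
  qed
  have "\<exists>\<^sub>\<infinity>k. \<not> z k"
  proof (rule ccontr)
    assume "\<not> (\<exists>\<^sub>\<infinity>k. \<not> z k)"
    then obtain m where m: "z k" if "k > m" for k by (auto simp: INFM_nat)
    \<comment> \<open>A tail of ones would have value 1, whereas every remainder stays below
      1.\<close>
    have "bin_val (\<lambda>k. z (k + Suc m)) = 1"
      using m sums_unique[OF sums_half_powers] by (simp add: bin_val_def)
    then show False using bin_val_rem[of "Suc m"] rem_range[of "Suc m"] by simp
  qed
  moreover have "bin_val z = r" using bin_val_rem[of 0] by (simp add: rem_def)
  ultimately show thesis by (rule that)
qed

lemma continuous_bin_val: "continuous_on A bin_val"
proof -
  have "uniform_limit A (\<lambda>n z. \<Sum>k<n. of_bool (z k) / 2 ^ Suc k) (\<lambda>z. \<Sum>k. of_bool (z k) / 2 ^ Suc k :: real) sequentially"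
    by (rule Weierstrass_m_test[OF _ sums_summable[OF sums_half_powers]]) auto
  moreover have "continuous_on A (\<lambda>z. of_bool (z k) :: real)" for k :: nat and A :: "(nat \<Rightarrow> bool) set"
  proof -
    have "continuous_on A (of_bool \<circ> (\<lambda>z. z k) :: _ \<Rightarrow> real)"
      by (intro continuous_on_compose continuous_on_subset[OF continuous_on_product_coordinates]) auto
    then show ?thesis by (simp add: o_def)
  qed
  ultimately show ?thesis
    unfolding bin_val_def
    by (intro uniform_limit_theorem[where A=A and F=sequentially]) (auto intro!: always_eventually continuous_intros)
qed

subsection \<open>Borel sets as injective projections\<close>

text \<open>Unique-witness form of the Lusin--Souslin representation: each point of \<open>S\<close>
  has exactly one Baire-space witness in \<open>C\<close>. Keeping the Cantor coordinate separate
  reduces closure properties to recoding witnesses.\<close>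

definition inj_projection :: "(nat \<Rightarrow> bool) set \<Rightarrow> bool" where
  "inj_projection S \<longleftrightarrow>
    (\<exists>C :: ((nat \<Rightarrow> bool) \<times> (nat \<Rightarrow> nat)) set. closed C \<and> fst ` C = S \<and> inj_on fst C)"

lemma closed_snd_coordinate: "closed {p :: (nat \<Rightarrow> bool) \<times> (nat \<Rightarrow> nat). snd p k \<in> X}"
proof -
  have "closed X" by (simp add: closed_def discrete_topology_class.open_discrete)
  moreover have "continuous_on UNIV (\<lambda>p :: (nat \<Rightarrow> bool) \<times> (nat \<Rightarrow> nat). snd p k)"
    by (rule continuous_on_product_then_coordinatewise) (intro continuous_intros)
  ultimately have "closed ((\<lambda>p :: (nat \<Rightarrow> bool) \<times> (nat \<Rightarrow> nat). snd p k) -` X)" by (rule closed_vimage)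
  then show ?thesis by (simp add: vimage_def)
qed

lemma inj_projection_closed:
  assumes "closed S"
  shows "inj_projection S"
  unfolding inj_projection_def
proof (intro exI conjI)
  let ?C = "(S \<times> UNIV) \<inter> (\<Inter>k. {p :: (nat \<Rightarrow> bool) \<times> (nat \<Rightarrow> nat). snd p k \<in> {0}})"
  show "closed ?C" using assms by (intro closed_Int closed_Times closed_INT ballI closed_snd_coordinate) auto
  show "fst ` ?C = S" by (force intro!: image_eqI[where x="(_, \<lambda>_. 0)"])
  show "inj_on fst ?C" by (auto simp: inj_on_def)
qed

text \<open>The first coordinate of a witness names the piece, the rest is a witness for that piece.
  Disjointness makes the name unique, hence the witness.\<close>

lemma inj_projection_UN:
  assumes "\<And>n::nat. inj_projection (S n)" "disjoint_family S"
  shows "inj_projection (\<Union>n. S n)"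
proof -
  have "\<forall>n. \<exists>C :: ((nat \<Rightarrow> bool) \<times> (nat \<Rightarrow> nat)) set. closed C \<and> fst ` C = S n \<and> inj_on fst C"
    using assms(1) by (simp add: inj_projection_def)
  then obtain C :: "nat \<Rightarrow> ((nat \<Rightarrow> bool) \<times> (nat \<Rightarrow> nat)) set" where
    C: "\<And>n. closed (C n)" "\<And>n. fst ` C n = S n" "\<And>n. inj_on fst (C n)" by metis
  define D where "D = {(z, x). (z, x \<circ> Suc) \<in> C (x 0)}"
  have memI: "z \<in> S n" if "(z, x) \<in> C n" for z x n
    using C(2)[of n] that by force
  \<comment> \<open>For each \<open>n\<close> either the name differs from \<open>n\<close>, a
    clopen condition, or the shifted witness lies in \<open>C n\<close>.\<close>
  have "D = (\<Inter>n. {p. snd p 0 \<noteq> n} \<union> {p. (fst p, \<lambda>k. snd p (Suc k)) \<in> C n})"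
    by (auto simp: D_def o_def)
  moreover have "closed {p :: (nat \<Rightarrow> bool) \<times> (nat \<Rightarrow> nat). snd p 0 \<noteq> n}" for n
    using closed_snd_coordinate[of 0 "- {n}"] by simp
  moreover have "closed {p. (fst p, \<lambda>k. snd p (Suc k)) \<in> C n}" for n
  proof -
    have "continuous_on UNIV (\<lambda>p :: (nat \<Rightarrow> bool) \<times> (nat \<Rightarrow> nat). (fst p, \<lambda>k. snd p (Suc k)))"
      by (intro continuous_intros continuous_on_coordinatewise_then_product
          continuous_on_product_then_coordinatewise[of _ snd])
    from closed_vimage[OF C(1) this, of n] show ?thesis by (simp add: vimage_def)
  qed
  ultimately have "closed D" by (auto intro!: closed_INT closed_Un)
  moreover have "fst ` D = (\<Union>n. S n)"
  proof safe
    fix z x assume "(z, x) \<in> D"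
    then show "fst (z, x) \<in> (\<Union>n. S n)" by (auto simp: D_def intro: memI)
  next
    fix z n assume "z \<in> S n"
    then obtain x where "(z, x) \<in> C n" using C(2)[of n] by force
    then have "(z, case_nat n x) \<in> D" by (simp add: D_def o_def)
    then show "z \<in> fst ` D" by force
  qed
  moreover have "inj_on fst D"
  proof (rule inj_onI, clarsimp)
    fix z x x' assume *: "(z, x) \<in> D" "(z, x') \<in> D"
    then have **: "(z, x \<circ> Suc) \<in> C (x 0)" "(z, x' \<circ> Suc) \<in> C (x' 0)" by (auto simp: D_def)
    with memI have "z \<in> S (x 0)" "z \<in> S (x' 0)" by blast+
    then have eq: "x 0 = x' 0" using assms(2) by (auto simp: disjoint_family_on_def)
    with ** inj_onD[OF C(3)[of "x 0"], of "(z, x \<circ> Suc)" "(z, x' \<circ> Suc)"]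
    have "x \<circ> Suc = x' \<circ> Suc" by simp
    then have "x (Suc k) = x' (Suc k)" for k by (metis comp_apply)
    with eq show "x = x'" by (metis ext nat.exhaust)
  qed
  ultimately show ?thesis unfolding inj_projection_def by blast
qed

text \<open>One witness interleaves, via \<open>prod_encode\<close>, the unique witnesses for all
  the \<open>S n\<close>.\<close>

lemma inj_projection_INT:
  assumes "\<And>n::nat. inj_projection (S n)"
  shows "inj_projection (\<Inter>n. S n)"
proof -
  have "\<forall>n. \<exists>C :: ((nat \<Rightarrow> bool) \<times> (nat \<Rightarrow> nat)) set. closed C \<and> fst ` C = S n \<and> inj_on fst C"
    using assms(1) by (simp add: inj_projection_def)
  then obtain C :: "nat \<Rightarrow> ((nat \<Rightarrow> bool) \<times> (nat \<Rightarrow> nat)) set" where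
    C: "\<And>n. closed (C n)" "\<And>n. fst ` C n = S n" "\<And>n. inj_on fst (C n)" by metis
  define D where "D = (\<Inter>n. {p. (fst p, \<lambda>k. snd p (prod_encode (n, k))) \<in> C n})"
  have "closed {p. (fst p, \<lambda>k. snd p (prod_encode (n, k))) \<in> C n}" for n
  proof -
    have "continuous_on UNIV (\<lambda>p :: (nat \<Rightarrow> bool) \<times> (nat \<Rightarrow> nat). (fst p, \<lambda>k. snd p (prod_encode (n, k))))"
      by (intro continuous_intros continuous_on_coordinatewise_then_product
          continuous_on_product_then_coordinatewise[of _ snd])
    from closed_vimage[OF C(1) this, of n] show ?thesis by (simp add: vimage_def)
  qed
  then have "closed D" by (auto simp: D_def)
  moreover have "fst ` D = (\<Inter>n. S n)"
  proof safe
    fix z x n assume "(z, x) \<in> D"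
    then show "fst (z, x) \<in> S n" using C(2)[of n] by (force simp: D_def)
  next
    fix z assume "z \<in> (\<Inter>n. S n)"
    then have "\<forall>n. \<exists>x. (z, x) \<in> C n" using C(2) by force
    then obtain x where x: "\<And>n. (z, x n) \<in> C n" by metis
    have "(z, \<lambda>m. case prod_decode m of (n, k) \<Rightarrow> x n k) \<in> D" using x by (simp add: D_def)
    then show "z \<in> fst ` D" by force
  qed
  moreover have "inj_on fst D"
  proof (rule inj_onI, clarsimp)
    fix z x x' assume *: "(z, x) \<in> D" "(z, x') \<in> D"
    have "x m = x' m" for m
    proof -
      obtain n k where m: "m = prod_encode (n, k)" by (metis prod_decode_inverse surj_pair)
      have "(\<lambda>k. x (prod_encode (n, k))) = (\<lambda>k. x' (prod_encode (n, k)))"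
        using * inj_onD[OF C(3)[of n], of "(z, \<lambda>k. x (prod_encode (n, k)))" "(z, \<lambda>k. x' (prod_encode (n, k)))"]
        by (simp add: D_def)
      then show ?thesis unfolding m by metis
    qed
    then show "x = x'" ..
  qed
  ultimately show ?thesis unfolding inj_projection_def by blast
qed

text \<open>The points of \<open>U\<close> are sorted by the length of the shortest prefix whose
  cylinder lies in \<open>U\<close>. Membership in a class depends on finitely many bits, so the
  classes are closed as well as disjoint.\<close>

lemma inj_projection_open:
  assumes "open U"
  shows "inj_projection U"
proof -
  define V where "V n = {z. cyl z n \<subseteq> U \<and> (\<forall>m<n. \<not> cyl z m \<subseteq> U)}" for n
  have cyl_eq: "cyl x m = cyl z m" if "x \<in> cyl z n" "m \<le> n" for x z m n
    using that by (auto simp: cyl_def)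
  have "closed (V n)" for n
    unfolding closed_def
  proof (rule open_if_cyl_subset)
    fix z assume "z \<in> - V n"
    then have "cyl z n \<subseteq> - V n"
      using cyl_eq[of _ z n] by (auto simp: V_def less_imp_le)
    then show "\<exists>n'. cyl z n' \<subseteq> - V n" by blast
  qed
  moreover have "disjoint_family V"
    unfolding disjoint_family_on_def
  proof (intro ballI impI)
    fix m n :: nat assume "m \<noteq> n"
    then show "V m \<inter> V n = {}" by (cases m n rule: linorder_cases) (auto simp: V_def)
  qed
  moreover have "U = (\<Union>n. V n)"
  proof safe
    fix z assume "z \<in> U"
    then have ex: "\<exists>n. cyl z n \<subseteq> U" using open_contains_cyl[OF assms] by metis
    have "z \<in> V (LEAST n. cyl z n \<subseteq> U)"
      using LeastI_ex[OF ex] not_less_Least by (auto simp: V_def)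
    then show "z \<in> (\<Union>n. V n)" by blast
  qed (auto simp: V_def cyl_def)
  ultimately show ?thesis
    using inj_projection_UN[of V] inj_projection_closed by simp
qed

text \<open>Induction over disjoint unions. Carrying the complement along makes the complement step
  trivial and turns the complement of a union into an intersection.\<close>

lemma inj_projection_borel:
  assumes "S \<in> sets borel"
  shows "inj_projection S"
proof -
  have "Int_stable {U :: (nat \<Rightarrow> bool) set. open U}" "{U :: (nat \<Rightarrow> bool) set. open U} \<subseteq> Pow UNIV"
    "S \<in> sigma_sets UNIV {U. open U}"
    using assms by (auto simp: sets_borel Int_stable_def)
  then have "inj_projection S \<and> inj_projection (UNIV - S)"
  proof (induction rule: sigma_sets_induct_disjoint)
    case (basic U)
    then show ?case by (simp add: inj_projection_open inj_projection_closed closed_Diff)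
  next
    case (union A)
    have "UNIV - (\<Union>n. A n) = (\<Inter>n. UNIV - A n)" by auto
    moreover have "inj_projection (\<Inter>n. UNIV - A n)" by (intro inj_projection_INT) (simp add: union)
    ultimately show ?case using union by (simp add: inj_projection_UN)
  next
    case (compl A)
    then show ?case by (simp add: double_diff)
  qed (simp add: inj_projection_closed)
  then show ?thesis ..
qed

section \<open>Borel sets of reals as injective images of closed sets in Baire space\<close>

abbreviation parity_val :: "(nat \<Rightarrow> nat) \<Rightarrow> real" where
  "parity_val y \<equiv> bin_val (\<lambda>k. odd (y k))"

lemma continuous_parity_val: "continuous_on A parity_val"
proof -
  have "continuous_on A (\<lambda>y k. odd (y k :: nat))" for A :: "(nat \<Rightarrow> nat) set"
  proof (rule continuous_on_coordinatewise_then_product)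
    fix k
    have "continuous_on A (odd \<circ> (\<lambda>y. y k))"
      by (intro continuous_on_compose continuous_on_subset[OF continuous_on_product_coordinates]) auto
    then show "continuous_on A (\<lambda>y. odd (y k))" by (simp add: o_def)
  qed
  then show ?thesis by (rule continuous_on_compose2[OF continuous_bin_val _ subset_UNIV])
qed

text \<open>Each \<open>y k\<close> stores two data: its parity is a binary digit of the real, and
  \<open>y k div 2\<close> is a coordinate of the witness for that digit sequence. Uniqueness of
  witnesses makes the digits determine \<open>y\<close>.\<close>

lemma borel_eq_parity_val_image:
  assumes B: "B \<in> sets borel" "B \<subseteq> {0<..<1}"
  obtains F where "closed F" "parity_val ` F = B" "inj_on parity_val F"
proof -
  \<comment> \<open>Excluding tails of ones makes \<open>bin_val\<close> injective on
    \<open>S\<close>.\<close>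
  define S where "S = bin_val -` B \<inter> {z. \<exists>\<^sub>\<infinity>k. \<not> z k}"
  have "bin_val \<in> borel_measurable borel"
    by (intro borel_measurable_continuous_onI continuous_bin_val)
  then have "bin_val -` B \<in> sets borel"
    using measurable_sets[OF _ B(1), of bin_val borel] by simp
  moreover have "{z :: nat \<Rightarrow> bool. \<exists>\<^sub>\<infinity>k. \<not> z k} = (\<Inter>m. \<Union>n\<in>{m<..}. {z. \<not> z n})"
    by (auto simp: INFM_nat)
  moreover have "open {z :: nat \<Rightarrow> bool. \<not> z n}" for n
  proof -
    have "open ((\<lambda>z. z n) -` {False} :: (nat \<Rightarrow> bool) set)"
      by (intro open_vimage discrete_topology_class.open_discrete continuous_on_product_coordinates)
    then show ?thesis by (simp add: vimage_def)
  qed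
  ultimately have "S \<in> sets borel"
    unfolding S_def by (auto intro!: sets.Int sets.countable_INT)
  then obtain C :: "((nat \<Rightarrow> bool) \<times> (nat \<Rightarrow> nat)) set" where
    C: "closed C" "fst ` C = S" "inj_on fst C"
    using inj_projection_borel by (auto simp: inj_projection_def)
  define F where "F = {y. (\<lambda>k. odd (y k), \<lambda>k. y k div 2) \<in> C}"
  have "continuous_on UNIV (\<lambda>y :: nat \<Rightarrow> nat. (\<lambda>k. odd (y k), \<lambda>k. y k div 2))"
  proof (intro continuous_on_Pair continuous_on_coordinatewise_then_product)
    fix k
    have "continuous_on UNIV (odd \<circ> (\<lambda>y::nat \<Rightarrow> nat. y k))" "continuous_on UNIV ((\<lambda>i. i div 2) \<circ> (\<lambda>y::nat \<Rightarrow> nat. y k))"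
      by (intro continuous_on_compose continuous_on_subset[OF continuous_on_product_coordinates]; simp)+
    then show "continuous_on UNIV (\<lambda>y::nat \<Rightarrow> nat. odd (y k))" "continuous_on UNIV (\<lambda>y::nat \<Rightarrow> nat. y k div 2)"
      by (simp_all add: o_def)
  qed
  from closed_vimage[OF C(1) this] have "closed F" by (simp add: F_def vimage_def)
  moreover have inS: "(\<lambda>k. odd (y k)) \<in> S" if "y \<in> F" for y
    using that C(2) by (force simp: F_def)
  have "parity_val ` F = B"
  proof safe
    fix y assume "y \<in> F"
    from inS[OF this] show "parity_val y \<in> B" by (simp add: S_def)
  next
    fix r assume "r \<in> B"
    then have "0 \<le> r" "r < 1" using B(2) by auto
    then obtain z where z: "\<exists>\<^sub>\<infinity>k. \<not> z k" "bin_val z = r" by (rule bin_val_surj)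
    with \<open>r \<in> B\<close> have "z \<in> S" by (simp add: S_def)
    then obtain x where x: "(z, x) \<in> C" using C(2) by force
    define y where "y k = 2 * x k + of_bool (z k)" for k
    have "(\<lambda>k. odd (y k)) = z" "(\<lambda>k. y k div 2) = x" by (auto simp: y_def)
    with x z(2) have "y \<in> F" "parity_val y = r" by (simp_all add: F_def)
    then show "r \<in> parity_val ` F" by blast
  qed
  moreover have "inj_on parity_val F"
  proof (rule inj_onI)
    fix y y' assume y: "y \<in> F" "y' \<in> F" "parity_val y = parity_val y'"
    have odd: "(\<lambda>k. odd (y k)) = (\<lambda>k. odd (y' k))"
      using inS[OF y(1)] inS[OF y(2)] y(3) by (intro bin_val_inj) (auto simp: S_def)
    with y(1,2) C(3) have "(\<lambda>k. y k div 2) = (\<lambda>k. y' k div 2)"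
      using inj_onD[OF C(3), of "(_, \<lambda>k. y k div 2)" "(_, \<lambda>k. y' k div 2)"] by (simp add: F_def)
    with odd have "odd (y k) = odd (y' k)" "y k div 2 = y' k div 2" for k by (metis)+
    then show "y = y'" by (intro ext) (metis bit_eq_rec)
  qed
  ultimately show thesis by (rule that)
qed

subsection \<open>Approaching a moving target\<close>

text \<open>Dyadic numbers in the unit interval are the measures of clopen sets; dyadicity lets a
  dead state settle at 0 or 1 in finitely many steps.\<close>

definition dyadic :: "real \<Rightarrow> bool" where
  "dyadic a \<longleftrightarrow> (\<exists>j. a * 2 ^ j \<in> \<int>)"

lemma dyadic_of_int: "dyadic (of_int k)"
  by (auto simp: dyadic_def intro: exI[of _ 0])

lemma dyadic_inverse_power: "dyadic (1 / 2 ^ j)"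
  by (auto simp: dyadic_def intro!: exI[of _ j])

lemma dyadic_add:
  assumes "dyadic a" "dyadic b"
  shows "dyadic (a + b)"
proof -
  obtain j k where "a * 2 ^ j \<in> \<int>" "b * 2 ^ k \<in> \<int>" using assms by (auto simp: dyadic_def)
  then have "a * 2 ^ j * 2 ^ k + b * 2 ^ k * 2 ^ j \<in> \<int>"
    by (intro Ints_add Ints_mult[where a="_ * _"]) (auto intro!: Ints_power)
  then have "(a + b) * 2 ^ (j + k) \<in> \<int>"
    by (simp add: algebra_simps power_add)
  then show ?thesis by (auto simp: dyadic_def)
qed

lemma dyadic_minus: "dyadic a \<Longrightarrow> dyadic (- a)"
  by (auto simp: dyadic_def)

lemma dyadic_diff: "dyadic a \<Longrightarrow> dyadic b \<Longrightarrow> dyadic (a - b)"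
  using dyadic_add[of a "- b"] dyadic_minus[of b] by simp

lemma dyadic_double: "dyadic a \<Longrightarrow> dyadic (2 * a)"
  using dyadic_add[of a a] by simp

lemma dyadic_sum: "(\<And>k. k \<in> K \<Longrightarrow> dyadic (f k)) \<Longrightarrow> dyadic (\<Sum>k\<in>K. f k)"
  using dyadic_of_int[of 0] by (induction K rule: infinite_finite_induct) (auto intro: dyadic_add)

lemma dyadic_max: "dyadic a \<Longrightarrow> dyadic b \<Longrightarrow> dyadic (max a b)"
  by (simp add: max_def)

lemma dyadic_min: "dyadic a \<Longrightarrow> dyadic b \<Longrightarrow> dyadic (min a b)"
  by (simp add: min_def)

text \<open>The midpoint of the dyadic interval determined by the first \<open>i\<close> digits:
  dyadic, and strictly between 0 and 1 even when all digits agree.\<close>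

definition target :: "(nat \<Rightarrow> nat) \<Rightarrow> nat \<Rightarrow> real" where
  "target y i = (\<Sum>k<i. of_bool (odd (y k)) / 2 ^ Suc k) + 1 / 2 ^ Suc i"

lemma dyadic_target: "dyadic (target y i)"
  unfolding target_def
proof (intro dyadic_add dyadic_sum dyadic_inverse_power)
  fix k
  show "dyadic (of_bool (odd (y k)) / 2 ^ Suc k)"
    using dyadic_inverse_power[of "Suc k"] dyadic_of_int[of 0] by (cases "odd (y k)") simp_all
qed

lemma target_range: "0 < target y i" "target y i < 1"
proof -
  show "0 < target y i"
    unfolding target_def by (intro add_nonneg_pos sum_nonneg) auto
  have "(\<Sum>k<i. of_bool (odd (y k)) / 2 ^ Suc k) \<le> (1 - 1 / 2 ^ i :: real)" for i
  proof (induction i)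
    case (Suc i)
    have "of_bool (odd (y i)) / 2 ^ Suc i \<le> (1 / 2 ^ Suc i :: real)" by (auto simp: divide_right_mono)
    with Suc show ?case by simp
  qed simp
  from this[of i] show "target y i < 1"
    unfolding target_def by (simp add: field_simps)
qed

lemma target_approx: "\<bar>target y i - parity_val y\<bar> \<le> 1 / 2 ^ i"
proof -
  have "0 \<le> bin_val (\<lambda>k. odd (y (k + i))) / 2 ^ i" "bin_val (\<lambda>k. odd (y (k + i))) / 2 ^ i \<le> 1 / 2 ^ i"
    using bin_val_range[of "\<lambda>k. odd (y (k + i))"] by (auto simp: divide_right_mono)
  moreover have "1 / 2 ^ Suc i \<le> (1 / 2 ^ i :: real)" "0 \<le> (1 / 2 ^ Suc i :: real)" by (auto simp: field_simps)
  ultimately show ?thesis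
    using bin_val_split[of "\<lambda>k. odd (y k)" i] unfolding target_def by linarith
qed

text \<open>The constraint is that the sibling density \<open>2 * d - approach d t\<close> lies in the unit interval.\<close>

definition approach :: "real \<Rightarrow> real \<Rightarrow> real" where
  "approach d t = max (2 * d - 1) (min (2 * d) t)"

lemma approach_range: "0 < d \<Longrightarrow> d < 1 \<Longrightarrow> 0 < t \<Longrightarrow> t < 1 \<Longrightarrow> 0 < approach d t \<and> approach d t < 1"
  by (auto simp: approach_def max_def min_def)

lemma approach_sibling_range: "approach d t \<le> 2 * d" "2 * d - approach d t \<le> 1"
  by (auto simp: approach_def)

text \<open>While targets are out of reach on one side, the distance of \<open>D\<close> from 0 or
  from 1 doubles at each step, which cannot go on; so some target is hit. Once targets stay close to
  \<open>r\<close>, a hit leaves the next target within reach, and \<open>D\<close> follows them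
  from then on.\<close>

lemma approach_tendsto:
  assumes t: "\<And>i. 0 < t i" "\<And>i. t i < 1" "t \<longlonglongrightarrow> r" "0 < r" "r < 1"
    and D: "0 < D 0" "D 0 < 1" "\<And>i. D (Suc i) = approach (D i) (t i)"
  shows "D \<longlonglongrightarrow> r"
proof -
  have D_range: "0 < D i" "D i < 1" for i
  proof -
    have "0 < D i \<and> D i < 1"
      by (induction i) (use D t in \<open>auto simp: approach_range\<close>)
    then show "0 < D i" "D i < 1" by auto
  qed
  \<comment> \<open>The margin is such that targets within \<open>e\<close> of \<open>r\<close>
    satisfy \<open>2 * t i - 1 < t (Suc i)\<close> and \<open>t (Suc i) < 2 * t i\<close>, so each
    is reachable from the one before.\<close>
  define e where "e = min r (1 - r) / 4"
  have e: "0 < e" "4 * e \<le> r" "4 * e \<le> 1 - r" using t(4,5) by (auto simp: e_def)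
  obtain i0 where i0: "\<And>i. i \<ge> i0 \<Longrightarrow> \<bar>t i - r\<bar> < e"
    using LIMSEQ_D[OF t(3) e(1)] by auto
  \<comment> \<open>A miss cannot change sides: after a miss from below, \<open>D (Suc i)\<close> is
    still less than \<open>t i\<close>, too small to overshoot the next target.\<close>
  have low_Suc: "2 * D (Suc i) < t (Suc i)"
    if "i \<ge> i0" "2 * D i < t i" "2 * D (Suc i) < t (Suc i) \<or> t (Suc i) < 2 * D (Suc i) - 1" for i
  proof -
    have "D (Suc i) = 2 * D i" using that t(2)[of i] D(3)[of i] by (auto simp: approach_def)
    then show ?thesis using that i0[of i] i0[of "Suc i"] e by auto
  qed
  have high_Suc: "t (Suc i) < 2 * D (Suc i) - 1"
    if "i \<ge> i0" "t i < 2 * D i - 1" "2 * D (Suc i) < t (Suc i) \<or> t (Suc i) < 2 * D (Suc i) - 1" for i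
  proof -
    have "D (Suc i) = 2 * D i - 1" using that t(1)[of i] D(3)[of i] by (auto simp: approach_def)
    then show ?thesis using that i0[of i] i0[of "Suc i"] e by auto
  qed
  have unbounded: False if "0 < c" "\<And>n. 2 ^ n * c < 1" for c :: real
  proof -
    obtain n where "1 / c < 2 ^ n" using real_arch_pow[of 2 "1 / c"] by auto
    then show False using that(1) that(2)[of n] by (simp add: field_simps)
  qed
  have "\<exists>i\<ge>i0. D (Suc i) = t i"
  proof (rule ccontr)
    assume "\<not> ?thesis"
    then have miss: "2 * D i < t i \<or> t i < 2 * D i - 1" if "i \<ge> i0" for i
      using that D(3)[of i] by (auto simp: approach_def max_def min_def split: if_splits)
    show False
      using miss[OF order_refl]
    proof
      assume low0: "2 * D i0 < t i0"
      have low: "2 * D (i0 + n) < t (i0 + n)" for n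
        by (induction n) (use low0 low_Suc miss in auto)
      have "D (i0 + n) = 2 ^ n * D i0" for n
      proof (induction n)
        case (Suc n)
        then show ?case using low[of n] D(3)[of "i0 + n"] t(2)[of "i0 + n"] by (auto simp: approach_def)
      qed simp
      then show False using unbounded[of "D i0"] D_range by metis
    next
      assume high0: "t i0 < 2 * D i0 - 1"
      have high: "t (i0 + n) < 2 * D (i0 + n) - 1" for n
        by (induction n) (use high0 high_Suc miss in auto)
      have "1 - D (i0 + n) = 2 ^ n * (1 - D i0)" for n
      proof (induction n)
        case (Suc n)
        then show ?case using high[of n] D(3)[of "i0 + n"] t(1)[of "i0 + n"] by (auto simp: approach_def)
      qed simp
      then have "2 ^ n * (1 - D i0) < 1" for n using D_range(1)[of "i0 + n"] by (metis diff_gt_0_iff_gt diff_less_eq less_add_same_cancel1)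
      then show False using unbounded[of "1 - D i0"] D_range(2)[of i0] by simp
    qed
  qed
  then obtain i1 where i1: "i1 \<ge> i0" "D (Suc i1) = t i1" by blast
  have hit: "D (Suc (i1 + n)) = t (i1 + n)" for n
  proof (induction n)
    case (Suc n)
    then show ?case
      using i1(1) i0[of "i1 + n"] i0[of "Suc (i1 + n)"] e D(3)[of "Suc (i1 + n)"] by (auto simp: approach_def)
  qed (use i1 in simp)
  have "(\<lambda>n. t (n + i1)) \<longlonglongrightarrow> r" using t(3) by (rule LIMSEQ_ignore_initial_segment)
  then have "(\<lambda>n. D (n + Suc i1)) \<longlonglongrightarrow> r" using hit by (simp add: add.commute)
  then show ?thesis by (rule LIMSEQ_offset)
qed

subsection \<open>The guessing automaton\<close>

text \<open>
  In \<open>(x, n, m)\<close> the current guess is \<open>x\<close>, its first \<open>n\<close> coordinates are final, and \<open>m\<close> encodes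
  the coordinate and the new value of the switch that is offered next.
\<close>

type_synonym guess = "(nat \<Rightarrow> nat) \<times> nat \<times> nat"

text \<open>For fixed \<open>x\<close> the codes \<open>m\<close> sort all \<open>y\<close>
  different from \<open>x\<close> by where and with which value they first depart from it.\<close>

definition exits :: "(nat \<Rightarrow> nat) \<Rightarrow> nat \<Rightarrow> (nat \<Rightarrow> nat) \<Rightarrow> bool" where
  "exits x m y \<longleftrightarrow> (\<forall>l<fst (prod_decode m). y l = x l) \<and>
     y (fst (prod_decode m)) = snd (prod_decode m) \<and> y (fst (prod_decode m)) \<noteq> x (fst (prod_decode m))"

lemma exits_unique:
  assumes "exits x m y" "exits x m' y"
  shows "m = m'"
proof -
  have "fst (prod_decode m) = fst (prod_decode m')"
    using assms by (auto simp: exits_def intro: linorder_cases[of "fst (prod_decode m)" "fst (prod_decode m')"])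
  then have "prod_decode m = prod_decode m'"
    using assms by (auto simp: exits_def prod_eq_iff)
  then show ?thesis by (metis prod_decode_inverse)
qed

lemma exits_ex:
  assumes "y \<noteq> x"
  obtains m where "exits x m y"
proof -
  define k where "k = (LEAST k. y k \<noteq> x k)"
  have "y k \<noteq> x k" unfolding k_def by (rule LeastI_ex) (use assms in blast)
  moreover have "y l = x l" if "l < k" for l using that not_less_Least unfolding k_def by blast
  ultimately have "exits x (prod_encode (k, y k)) y" by (simp add: exits_def)
  then show thesis by (rule that)
qed

lemma exits_neq: "exits x m y \<Longrightarrow> y \<noteq> x"
  by (auto simp: exits_def)

text \<open>\<open>Dead a\<close> spends density \<open>a\<close> on a clopen set. The other two
  states alternate, carrying the current density and the round number, which is also the number of
  digits used for the target.\<close>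

datatype state = Dead real | Adjust guess real nat | Branch guess real nat

locale tracking =
  fixes F :: "(nat \<Rightarrow> nat) set"
begin

definition alternative :: "guess \<Rightarrow> (nat \<Rightarrow> nat) \<Rightarrow> bool" where
  "alternative g y \<longleftrightarrow>
    fst (snd g) \<le> fst (prod_decode (snd (snd g))) \<and> exits (fst g) (snd (snd g)) y \<and> y \<in> F"

text \<open>Any alternative serves, since later switches can still alter the coordinates beyond the
  one changed. Committing through that coordinate preserves the correction, and the clock restarts
  so that departures from the new guess are offered in turn.\<close>

definition switch :: "guess \<Rightarrow> guess" where
  "switch g = (SOME y. alternative g y, Suc (fst (prod_decode (snd (snd g)))), 0)"

lemma alternative_switch: "alternative g y \<Longrightarrow> alternative g (fst (switch g))"
  using someI[of "alternative g"] by (simp add: switch_def)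

definition stay :: "guess \<Rightarrow> guess" where
  "stay g = (fst g, fst (snd g), Suc (snd (snd g)))"

text \<open>For dyadic \<open>a\<close> in the unit interval, the set accepted from
  \<open>Dead a\<close> is the lexicographically first clopen set of measure \<open>a\<close>. At
  \<open>Adjust\<close> the bit \<open>True\<close> receives the density left over; at
  \<open>Branch\<close> both successors keep \<open>d\<close>, and a dead state fills the place of a
  missing alternative.\<close>

fun step :: "state \<Rightarrow> bool \<Rightarrow> state" where
  "step (Dead a) b = Dead (if b then max 0 (2 * a - 1) else min 1 (2 * a))"
| "step (Adjust g d i) b =
    (if b then Dead (2 * d - approach d (target (fst g) i)) else Branch g (approach d (target (fst g) i)) i)"
| "step (Branch g d i) b =
    (if \<not> b then Adjust (stay g) d (Suc i)
     else if \<exists>y. alternative g y then Adjust (switch g) d (Suc i) else Dead d)"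

fun dens :: "state \<Rightarrow> real" where
  "dens (Dead a) = a"
| "dens (Adjust g d i) = d"
| "dens (Branch g d i) = d"

fun valid :: "state \<Rightarrow> bool" where
  "valid (Dead a) \<longleftrightarrow> 0 \<le> a \<and> a \<le> 1 \<and> dyadic a"
| "valid (Adjust g d i) \<longleftrightarrow> 0 < d \<and> d < 1 \<and> dyadic d"
| "valid (Branch g d i) \<longleftrightarrow> 0 < d \<and> d < 1 \<and> dyadic d"

text \<open>The constants fit the rate \<open>9/10\<close>: two \<open>Adjust\<close> successors of
  a \<open>Branch\<close> give \<open>18/5\<close>, exactly \<open>2 * 9/10 * 2\<close>; an
  \<open>Adjust\<close> yields at most \<open>2 + 1\<close>, below \<open>2 * 9/10 * 9/5\<close>;
  and a dead state strictly inside the unit interval has at least one successor at 0 or 1.\<close>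

fun weight :: "state \<Rightarrow> real" where
  "weight (Dead a) = of_bool (a \<notin> {0, 1})"
| "weight (Adjust g d i) = 9/5"
| "weight (Branch g d i) = 2"

lemma dyadic_approach: "dyadic d \<Longrightarrow> dyadic (approach d (target y i))"
  using dyadic_of_int[of 1] unfolding approach_def
  by (intro dyadic_max dyadic_min dyadic_diff dyadic_double dyadic_target) auto

lemma dyadic_0_1: "dyadic 0" "dyadic 1"
  using dyadic_of_int[of 0] dyadic_of_int[of 1] by simp_all

sublocale harmonic_automaton "Collect valid" step dens weight "9/10"
proof
  fix q b assume "q \<in> Collect valid"
  then show "step q b \<in> Collect valid"
    by (cases q) (auto simp: approach_range approach_sibling_range target_range dyadic_approach
        intro!: dyadic_max dyadic_min dyadic_diff dyadic_double dyadic_0_1)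
qed (auto elim!: valid.elims)

text \<open>Each step doubles, up to subtracting 1 or clamping, and so removes one factor 2 from the
  denominator; an integer in the unit interval remains.\<close>

lemma run_Dead_extreme:
  assumes "0 \<le> a" "a \<le> 1" "a * 2 ^ j \<in> \<int>"
  shows "dens (run step (Dead a) z j) \<in> {0, 1}"
  using assms
proof (induction j arbitrary: a z)
  case 0
  then show ?case by (auto simp: Ints_def)
next
  case (Suc j)
  let ?a = "if z 0 then max 0 (2 * a - 1) else min 1 (2 * a)"
  have "2 * a * 2 ^ j \<in> \<int>" using Suc.prems(3) by (simp add: mult_ac)
  moreover from this have "2 * a * 2 ^ j - 2 ^ j \<in> \<int>" by (intro Ints_diff Ints_power) auto
  ultimately have "?a * 2 ^ j \<in> \<int>" by (auto simp: max_def min_def algebra_simps)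
  then have "dens (run step (Dead ?a) (z \<circ> Suc) j) \<in> {0, 1}"
    using Suc.prems by (intro Suc.IH) auto
  then show ?case unfolding run_Suc_shift by simp
qed

lemma run_add: "run step q z (m + n) = run step (run step q z m) (\<lambda>i. z (m + i)) n"
  by (induction n) auto

lemma dens_tendsto_Dead:
  assumes "valid q" "run step q z m = Dead a"
  obtains r where "r \<in> {0, 1}" "(\<lambda>n. dens (run step q z n)) \<longlonglongrightarrow> r"
proof -
  have "valid (Dead a)" using run_closed[of q z m] assms by simp
  then obtain j where j: "0 \<le> a" "a \<le> 1" "a * 2 ^ j \<in> \<int>" by (auto simp: dyadic_def)
  define r where "r = dens (run step q z (m + j))"
  have r: "r \<in> {0, 1}"
    unfolding r_def run_add assms(2) using j by (rule run_Dead_extreme)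
  have "dens (run step q z (n + (m + j))) = r" for n
  proof -
    have "run step q z (m + j) \<in> Collect valid" using run_closed[of q z "m + j"] assms(1) by simp
    from dens_run_extreme[OF this, of _ n] r show ?thesis
      by (metis r_def add.commute run_add)
  qed
  then have "(\<lambda>n. dens (run step q z (n + (m + j)))) \<longlonglongrightarrow> r" by simp
  then have "(\<lambda>n. dens (run step q z n)) \<longlonglongrightarrow> r" by (rule LIMSEQ_offset)
  with r show thesis by (rule that)
qed

end

section \<open>Convergence of the guesses along surviving branches\<close>

locale tracking_from = tracking +
  fixes y0 :: "nat \<Rightarrow> nat"
  assumes y0: "y0 \<in> F" and closed_F: "closed F"
begin

primrec guesses :: "(nat \<Rightarrow> bool) \<Rightarrow> nat \<Rightarrow> guess" where
  "guesses w 0 = (y0, 0, 0)"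
| "guesses w (Suc i) = (if w i then switch (guesses w i) else stay (guesses w i))"

declare guesses.simps(2) [simp del]

primrec approx :: "(nat \<Rightarrow> bool) \<Rightarrow> nat \<Rightarrow> real" where
  "approx w 0 = 1/2"
| "approx w (Suc i) = approach (approx w i) (target (fst (guesses w i)) i)"

text \<open>Excludes switches to missing alternatives, where \<open>switch\<close> would return an
  arbitrary point and the automaton dies instead.\<close>

definition admissible :: "(nat \<Rightarrow> bool) \<Rightarrow> bool" where
  "admissible w \<longleftrightarrow> (\<forall>i. w i \<longrightarrow> (\<exists>y. alternative (guesses w i) y))"

abbreviation current :: "(nat \<Rightarrow> bool) \<Rightarrow> nat \<Rightarrow> nat \<Rightarrow> nat" where
  "current w i \<equiv> fst (guesses w i)"

abbreviation committed :: "(nat \<Rightarrow> bool) \<Rightarrow> nat \<Rightarrow> nat" where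
  "committed w i \<equiv> fst (snd (guesses w i))"

abbreviation clock :: "(nat \<Rightarrow> bool) \<Rightarrow> nat \<Rightarrow> nat" where
  "clock w i \<equiv> snd (snd (guesses w i))"

lemma guesses_cong: "(\<And>j. j < i \<Longrightarrow> w j = w' j) \<Longrightarrow> guesses w i = guesses w' i"
  by (induction i) (auto simp: guesses.simps)

lemma guesses_stay:
  assumes "\<not> w i"
  shows "current w (Suc i) = current w i" "committed w (Suc i) = committed w i" "clock w (Suc i) = Suc (clock w i)"
  using assms by (simp_all add: guesses.simps stay_def)

lemma guesses_switch:
  assumes "admissible w" "w i"
  shows "exits (current w i) (clock w i) (current w (Suc i))" "current w (Suc i) \<in> F"
    "committed w i \<le> fst (prod_decode (clock w i))"
    "committed w (Suc i) = Suc (fst (prod_decode (clock w i)))" "clock w (Suc i) = 0"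
proof -
  have "alternative (guesses w i) (fst (switch (guesses w i)))"
    using assms alternative_switch unfolding admissible_def by blast
  then show "exits (current w i) (clock w i) (current w (Suc i))" "current w (Suc i) \<in> F"
    "committed w i \<le> fst (prod_decode (clock w i))"
    "committed w (Suc i) = Suc (fst (prod_decode (clock w i)))" "clock w (Suc i) = 0"
    using assms(2) by (simp_all add: guesses.simps alternative_def) (simp_all add: switch_def)
qed

lemma current_in_F: "admissible w \<Longrightarrow> current w i \<in> F"
proof (induction i)
  case (Suc i)
  then show ?case using guesses_switch(2)[of w i] guesses_stay(1)[of w i] by (cases "w i") auto
qed (simp add: y0)

text \<open>A switch changes no coordinate before the offered one, which lies at or beyond the
  committed bound.\<close>

lemma committed_Suc:
  assumes "admissible w"
  shows "committed w i \<le> committed w (Suc i)" "l < committed w i \<Longrightarrow> current w (Suc i) l = current w i l"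
proof -
  show "committed w i \<le> committed w (Suc i)"
    using guesses_switch(3,4)[OF assms, of i] guesses_stay(2)[of w i] by (cases "w i") auto
  show "current w (Suc i) l = current w i l" if "l < committed w i"
    using that guesses_switch(1,3)[OF assms, of i] guesses_stay(1)[of w i] by (cases "w i") (auto simp: exits_def)
qed

lemma committed_stable:
  assumes "admissible w" "i \<le> i'" "l < committed w i"
  shows "current w i' l = current w i l \<and> l < committed w i'"
  using assms(2)
proof (induction i' rule: dec_induct)
  case (step j)
  then show ?case using committed_Suc(1)[OF assms(1), of j] committed_Suc(2)[OF assms(1), of l j] by auto
qed (use assms in simp)

lemma committed_unbounded:
  assumes "admissible w" "\<exists>\<^sub>\<infinity>i. w i"
  shows "\<exists>i. l < committed w i"
proof (induction l)
  case 0
  obtain i where "w i" using assms(2) INFM_EX by blast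
  then show ?case using guesses_switch(4)[OF assms(1)] by (metis zero_less_Suc)
next
  case (Suc l)
  then obtain i where i: "l < committed w i" by blast
  obtain i' where i': "i' > i" "w i'" using assms(2) by (auto simp: INFM_nat)
  then have "l < committed w i'" using committed_stable[OF assms(1) _ i, of i'] by simp
  then have "Suc l < committed w (Suc i')"
    using guesses_switch(3,4)[OF assms(1) i'(2)] by linarith
  then show ?case by blast
qed

lemma guesses_no_switch:
  assumes "\<And>j. i \<le> j \<Longrightarrow> j < i + n \<Longrightarrow> \<not> w j"
  shows "current w (i + n) = current w i \<and> clock w (i + n) = clock w i + n"
  using assms
proof (induction n)
  case (Suc n)
  then show ?case using guesses_stay[of w "i + n"] by simp
qed simp

lemma eventually_constant:
  assumes "\<not> (\<exists>\<^sub>\<infinity>i. w i)"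
  obtains i where "\<And>n. current w (i + n) = current w i \<and> clock w (i + n) = clock w i + n"
proof -
  obtain i where "\<And>j. j > i \<Longrightarrow> \<not> w j" using assms by (auto simp: INFM_nat)
  then have "current w (Suc i + n) = current w (Suc i) \<and> clock w (Suc i + n) = clock w (Suc i) + n" for n
    by (intro guesses_no_switch) auto
  then show thesis by (rule that)
qed

definition limit :: "(nat \<Rightarrow> bool) \<Rightarrow> nat \<Rightarrow> nat" where
  "limit w l = (SOME c. \<forall>\<^sub>F i in sequentially. current w i l = c)"

text \<open>With infinitely many switches the coordinate is eventually committed; with finitely many
  the whole guess is eventually constant.\<close>

lemma limit_coordinate:
  assumes "admissible w"
  shows "\<forall>\<^sub>F i in sequentially. current w i l = limit w l"
proof -
  have "\<exists>c. \<forall>\<^sub>F i in sequentially. current w i l = c"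
  proof (cases "\<exists>\<^sub>\<infinity>i. w i")
    case True
    then obtain i where i: "l < committed w i" using committed_unbounded[OF assms] by blast
    then have "\<forall>i'\<ge>i. current w i' l = current w i l" using committed_stable[OF assms] by blast
    then show ?thesis by (auto simp: eventually_sequentially)
  next
    case False
    then obtain i where "\<And>n. current w (i + n) = current w i" using eventually_constant by metis
    then have "\<forall>i'\<ge>i. current w i' l = current w i l" by (metis le_Suc_ex)
    then show ?thesis by (auto simp: eventually_sequentially)
  qed
  then show ?thesis unfolding limit_def by (rule someI_ex)
qed

lemma limit_unique:
  assumes "admissible w" "\<forall>\<^sub>F i in sequentially. current w i l = c"
  shows "limit w l = c"
proof -
  have "\<forall>\<^sub>F i in sequentially. limit w l = c"
    using limit_coordinate[OF assms(1), of l] assms(2) by eventually_elim simp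
  then show ?thesis by simp
qed

lemma limit_eqI:
  assumes "admissible w" "\<And>j. i \<le> j \<Longrightarrow> current w j l = c"
  shows "limit w l = c"
  using assms by (intro limit_unique) (auto simp: eventually_sequentially)

lemma limit_committed:
  assumes "admissible w" "l < committed w i"
  shows "limit w l = current w i l"
  by (rule limit_eqI[OF assms(1), of i]) (use committed_stable[OF assms(1) _ assms(2)] in blast)

lemma current_tendsto:
  assumes "admissible w"
  shows "current w \<longlonglongrightarrow> limit w"
proof -
  have "(\<lambda>i. current w i l) \<longlonglongrightarrow> limit w l" for l
    using limit_coordinate[OF assms] by (simp add: tendsto_discrete)
  then have "limitin (product_topology (\<lambda>_. euclidean) UNIV) (current w) (limit w) sequentially"
    by (simp add: limitin_componentwise)
  then show ?thesis by (simp add: euclidean_product_topology)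
qed

lemma limit_in_F:
  assumes "admissible w"
  shows "limit w \<in> F"
  using current_in_F[OF assms]
  by (intro Lim_in_closed_set[OF closed_F _ _ current_tendsto[OF assms]]) auto

lemma approx_tendsto:
  assumes "admissible w" "0 < parity_val (limit w)" "parity_val (limit w) < 1"
  shows "approx w \<longlonglongrightarrow> parity_val (limit w)"
proof (rule approach_tendsto)
  have "(\<lambda>i. parity_val (current w i)) \<longlonglongrightarrow> parity_val (limit w)"
    by (rule continuous_on_tendsto_compose[OF continuous_parity_val[of UNIV] current_tendsto[OF assms(1)]]) auto
  moreover have "(\<lambda>i. target (current w i) i - parity_val (current w i)) \<longlonglongrightarrow> 0"
  proof (rule Lim_null_comparison)
    show "\<forall>\<^sub>F i in sequentially. norm (target (current w i) i - parity_val (current w i)) \<le> (1/2) ^ i"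
      using target_approx by (simp add: power_divide)
    show "(\<lambda>i. (1/2) ^ i :: real) \<longlonglongrightarrow> 0" by (intro LIMSEQ_power_zero) auto
  qed
  ultimately show "(\<lambda>i. target (current w i) i) \<longlonglongrightarrow> parity_val (limit w)"
    using tendsto_add by fastforce
qed (use assms target_range in auto)

text \<open>A switch commits every coordinate through the offered one, so the limit departs from the
  old guess as the new guess does.\<close>

lemma limit_exits:
  assumes "admissible w" "w i"
  shows "exits (current w i) (clock w i) (limit w)"
proof -
  have "limit w l = current w (Suc i) l" if "l \<le> fst (prod_decode (clock w i))" for l
    using that guesses_switch(4)[OF assms] by (intro limit_committed[OF assms(1)]) simp
  then show ?thesis using guesses_switch(1)[OF assms] by (auto simp: exits_def)
qed

lemma limit_exits_later:
  assumes "admissible w" "limit w \<noteq> current w i"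
  obtains n where "exits (current w i) (clock w i + n) (limit w)"
proof (cases "\<exists>j\<ge>i. w j")
  case True
  \<comment> \<open>Up to the first later switch the guess is unchanged and the clock counts rounds,
    so the departure code is the clock value plus the waiting time.\<close>
  define j where "j = (LEAST j. i \<le> j \<and> w j)"
  have j: "i \<le> j" "w j" using LeastI_ex[of "\<lambda>j. i \<le> j \<and> w j"] True by (auto simp: j_def)
  have "\<not> w l" if "i \<le> l" "l < i + (j - i)" for l
    using that j(1) not_less_Least[of l "\<lambda>j. i \<le> j \<and> w j"] by (auto simp: j_def)
  then have "current w (i + (j - i)) = current w i \<and> clock w (i + (j - i)) = clock w i + (j - i)"
    by (rule guesses_no_switch)
  with limit_exits[OF assms(1) j(2)] j(1) show thesis by (intro that[of "j - i"]) simp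
next
  case False
  have "current w (i + n) = current w i" for n using guesses_no_switch[of i n w] False by simp
  then have "current w j l = current w i l" if "i \<le> j" for j l using that by (metis le_Suc_ex)
  then have "limit w l = current w i l" for l
    by (intro limit_eqI[OF assms(1), of i])
  with assms(2) show thesis by blast
qed

text \<open>Where two branches first diverge, one switches, so the common limit departs from the
  shared guess by the present code. The other stays, so the limit can depart only by a later code,
  contradicting \<open>exits_unique\<close>.\<close>

lemma limit_inj:
  assumes "admissible w" "admissible w'" "limit w = limit w'"
  shows "w = w'"
proof (rule ccontr)
  assume "w \<noteq> w'"
  define i where "i = (LEAST i. w i \<noteq> w' i)"
  have i: "w i \<noteq> w' i" unfolding i_def by (rule LeastI_ex) (use \<open>w \<noteq> w'\<close> in blast)
  have "w j = w' j" if "j < i" for j using that not_less_Least unfolding i_def by blast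
  then have eq: "guesses w i = guesses w' i" by (rule guesses_cong)
  have contra: False
    if uv: "admissible u" "admissible v" "limit u = limit v" "guesses u i = guesses v i" "u i" "\<not> v i" for u v
  proof -
    have u: "exits (current v i) (clock v i) (limit v)" using limit_exits[OF uv(1,5)] uv(3,4) by simp
    then have "limit v \<noteq> current v (Suc i)" using exits_neq guesses_stay(1)[of v i] uv(6) by metis
    then obtain n where "exits (current v (Suc i)) (clock v (Suc i) + n) (limit v)"
      using limit_exits_later[OF uv(2)] by blast
    with guesses_stay[of v i] uv(6) have "exits (current v i) (Suc (clock v i) + n) (limit v)" by simp
    from exits_unique[OF u this] show False by simp
  qed
  show False
  proof (cases "w i")
    case True
    with i have "\<not> w' i" by simp
    with True show False by (rule contra[OF assms eq])
  next
    case False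
    with i have "w' i" by simp
    then show False using False by (rule contra[OF assms(2,1) assms(3)[symmetric] eq[symmetric]])
  qed
qed

lemma limit_surj:
  assumes "y \<in> F"
  obtains w where "admissible w" "limit w = y"
proof -
  \<comment> \<open>Switch exactly when the offer is the departure of \<open>y\<close> from the
    current guess.\<close>
  define G where "G = rec_nat (y0, 0, 0) (\<lambda>_ g. if exits (fst g) (snd (snd g)) y then switch g else stay g)"
  define w where "w i \<longleftrightarrow> exits (fst (G i)) (snd (snd (G i))) y" for i
  have "guesses w i = G i" for i
    by (induction i) (auto simp: guesses.simps G_def w_def)
  then have w: "w i \<longleftrightarrow> exits (current w i) (clock w i) y" for i by (simp add: w_def)
  \<comment> \<open>Committed coordinates agree with \<open>y\<close>, and the clock has not passed
    the code by which \<open>y\<close> departs; hence the offer is never missed and is a legitimate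
    alternative when it comes.\<close>
  have inv: "(\<forall>l<committed w i. y l = current w i l) \<and> (\<forall>m. exits (current w i) m y \<longrightarrow> clock w i \<le> m)
      \<and> (w i \<longrightarrow> alternative (guesses w i) y)" for i
  proof (induction i)
    case 0
    then show ?case using w[of 0] assms by (auto simp: alternative_def)
  next
    case (Suc i)
    have "(\<forall>l<committed w (Suc i). y l = current w (Suc i) l) \<and> (\<forall>m. exits (current w (Suc i)) m y \<longrightarrow> clock w (Suc i) \<le> m)"
    proof (cases "w i")
      case True
      then have "alternative (guesses w i) y" using Suc by blast
      then have "exits (current w i) (clock w i) (current w (Suc i))"
        using True alternative_switch[of "guesses w i" y] by (simp add: guesses.simps alternative_def)
      moreover have "exits (current w i) (clock w i) y" using True w by simp
      ultimately have "y l = current w (Suc i) l" if "l \<le> fst (prod_decode (clock w i))" for l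
        using that by (cases "l = fst (prod_decode (clock w i))") (auto simp: exits_def)
      moreover have "committed w (Suc i) = Suc (fst (prod_decode (clock w i)))" "clock w (Suc i) = 0"
        using True by (simp_all add: guesses.simps switch_def)
      ultimately show ?thesis by simp
    next
      case False
      then have "clock w i \<noteq> m" if "exits (current w i) m y" for m using that w by blast
      with False Suc show ?thesis
        using guesses_stay[of w i] by (simp add: le_neq_implies_less Suc_le_eq)
    qed
    moreover from this have "alternative (guesses w (Suc i)) y" if "w (Suc i)"
    proof -
      from that w have ex: "exits (current w (Suc i)) (clock w (Suc i)) y" by blast
      have "\<not> fst (prod_decode (clock w (Suc i))) < committed w (Suc i)"
        using calculation ex unfolding exits_def by blast
      with ex assms show ?thesis by (simp add: alternative_def not_less)
    qed
    ultimately show ?case by blast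
  qed
  then have adm: "admissible w" by (auto simp: admissible_def)
  have "limit w = y"
  proof (cases "\<exists>\<^sub>\<infinity>i. w i")
    case True
    show ?thesis
    proof
      fix l
      obtain i where "l < committed w i" using committed_unbounded[OF adm True] by blast
      then show "limit w l = y l" using limit_committed[OF adm] inv by simp
    qed
  next
    case False
    then obtain i where i: "\<And>n. current w (i + n) = current w i \<and> clock w (i + n) = clock w i + n"
      using eventually_constant by blast
    \<comment> \<open>A final guess other than \<open>y\<close> would have a departure code that the
      growing clock eventually passes, against the invariant.\<close>
    have "current w i = y"
    proof (rule ccontr)
      assume "current w i \<noteq> y"
      then obtain m where "exits (current w i) m y" using exits_ex by metis
      then have "clock w (i + Suc m) \<le> m" using inv[of "i + Suc m"] i[of "Suc m"] by metis
      then show False using i[of "Suc m"] by simp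
    qed
    then have "current w j l = y l" if "i \<le> j" for j l using that i by (metis le_Suc_ex)
    then show ?thesis by (intro ext limit_eqI[OF adm, of i])
  qed
  with adm show thesis by (rule that)
qed

section \<open>Bit sequences and choice sequences\<close>

abbreviation start :: state where "start \<equiv> Adjust (y0, 0, 0) (1/2) 0"

text \<open>Rounds take two bits: the even one must be \<open>False\<close> to survive adjustment,
  the odd one is the choice.\<close>

definition choices :: "(nat \<Rightarrow> bool) \<Rightarrow> nat \<Rightarrow> bool" where
  "choices z i = z (Suc (2 * i))"

lemma run_live:
  assumes "\<And>j. j < i \<Longrightarrow> \<not> z (2 * j)"
    and "\<And>j. j < i \<Longrightarrow> choices z j \<Longrightarrow> \<exists>y. alternative (guesses (choices z) j) y"
  shows "run step start z (2 * i) = Adjust (guesses (choices z) i) (approx (choices z) i) i"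
  using assms
proof (induction i)
  case (Suc i)
  then have "run step start z (2 * i) = Adjust (guesses (choices z) i) (approx (choices z) i) i" by simp
  with Suc.prems(1)[of i] Suc.prems(2)[of i] show ?case by (auto simp: guesses.simps simp flip: choices_def)
qed simp

lemma live_if_not_Dead:
  assumes "\<And>n a. run step start z n \<noteq> Dead a"
  shows "admissible (choices z)" "\<not> z (2 * i)"
proof -
  have "\<not> z (2 * i) \<and> (choices z i \<longrightarrow> (\<exists>y. alternative (guesses (choices z) i) y))" for i
  proof (induction i rule: less_induct)
    case (less i)
    then have r: "run step start z (2 * i) = Adjust (guesses (choices z) i) (approx (choices z) i) i"
      by (intro run_live) auto
    have "\<not> z (2 * i)" using assms[of "Suc (2 * i)"] r by (metis run.simps(2) step.simps(2))
    moreover have "\<exists>y. alternative (guesses (choices z) i) y" if "choices z i"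
      using assms[of "Suc (Suc (2 * i))" "approx (choices z) (Suc i)"] r that \<open>\<not> z (2 * i)\<close>
      by (auto simp flip: choices_def split: if_splits)
    ultimately show ?case by blast
  qed
  then show "admissible (choices z)" "\<not> z (2 * i)" by (auto simp: admissible_def)
qed

lemma dens_tendsto_live:
  assumes "admissible (choices z)" "\<And>i. \<not> z (2 * i)"
    and "0 < parity_val (limit (choices z))" "parity_val (limit (choices z)) < 1"
  shows "(\<lambda>n. dens (run step start z n)) \<longlonglongrightarrow> parity_val (limit (choices z))"
proof -
  have even: "run step start z (2 * i) = Adjust (guesses (choices z) i) (approx (choices z) i) i" for i
    using assms by (intro run_live) (auto simp: admissible_def)
  \<comment> \<open>Adjustment happens at the even bit, so at odd times the density is already that
    of the next round; hence the rounding up.\<close>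
  have "dens (run step start z n) = approx (choices z) (Suc n div 2)" for n
  proof (cases "even n")
    case True
    then obtain i where "n = 2 * i" by blast
    then show ?thesis using even[of i] by simp
  next
    case False
    then obtain i where "n = Suc (2 * i)" using oddE by fastforce
    then show ?thesis using even[of i] assms(2)[of i] by simp
  qed
  moreover have "filterlim (\<lambda>n::nat. Suc n div 2) sequentially sequentially"
    unfolding filterlim_at_top
  proof
    fix N :: nat
    show "\<forall>\<^sub>F n in sequentially. N \<le> Suc n div 2"
      using eventually_ge_at_top[of "2 * N"] by eventually_elim simp
  qed
  ultimately show ?thesis
    using filterlim_compose[OF approx_tendsto[OF assms(1,3,4)]] by simp
qed

end

subsection \<open>Solid sets with prescribed density range\<close>

text \<open>Dead points get density 0 or 1; live points correspond bijectively to \<open>F\<close>,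
  each having as density the parity value of its limit. Injectivity of \<open>parity_val\<close> on
  \<open>F\<close> then gives \<open>Rng_inj\<close>.\<close>

lemma open_solid_set_exists:
  assumes B: "B \<in> sets borel" "B \<subseteq> {0<..<1}"
  shows "\<exists>A. openin cantor_top A \<and> A \<in> sets cantor_measure \<and> solid A \<and> ran_density A = {0, 1} \<union> B \<and> Rng_inj A"
proof -
  obtain F where F: "closed F" "parity_val ` F = B" "inj_on parity_val F"
    using borel_eq_parity_val_image[OF B] .
  interpret tracking F .
  \<comment> \<open>An empty \<open>F\<close> offers no initial guess; \<open>Dead (1/2)\<close>
    still produces exactly the densities 0 and 1.\<close>
  define q where "q = (if F = {} then Dead (1/2) else Adjust (SOME y. y \<in> F, 0, 0) (1/2) 0)"
  have half: "dyadic (1/2)" using dyadic_inverse_power[of 1] by simp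
  have q: "q \<in> Collect valid" using half by (simp add: q_def)
  have density: "density_at (acc q) z r \<longleftrightarrow> (\<lambda>n. dens (run step q z n)) \<longlonglongrightarrow> r" for z r
    unfolding density_at_def by (subst dens_seq_acc[OF q, abs_def]) simp
  define live where "live z \<longleftrightarrow> (\<forall>n a. run step q z n \<noteq> Dead a)" for z
  have dead: "\<exists>r\<in>{0, 1}. density_at (acc q) z r" if "\<not> live z" for z
    using that dens_tendsto_Dead[of q z] q unfolding live_def density by (metis mem_Collect_eq)
  have val: "0 < parity_val y" "parity_val y < 1" if "y \<in> F" for y
    using that F(2) B(2) by auto
  have "\<exists>g. (\<forall>z. live z \<longrightarrow> g z \<in> F \<and> density_at (acc q) z (parity_val (g z))) \<and>
      inj_on g (Collect live) \<and> F \<subseteq> g ` Collect live"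
  proof (cases "F = {}")
    case True
    then have "run step q z 0 = Dead (1/2)" for z by (simp add: q_def)
    then have "\<not> live z" for z unfolding live_def by blast
    with True show ?thesis by (simp add: inj_on_def)
  next
    case False
    then have "(SOME y. y \<in> F) \<in> F" by (simp add: some_in_eq)
    then interpret tracking_from F "SOME y. y \<in> F" by unfold_locales (auto simp: F)
    have q_start: "q = start" using False by (simp add: q_def)
    let ?g = "\<lambda>z. limit (choices z)"
    have "?g z \<in> F \<and> density_at (acc q) z (parity_val (?g z))" if "live z" for z
    proof -
      have z: "admissible (choices z)" "\<And>i. \<not> z (2 * i)"
        using live_if_not_Dead[of z] that unfolding live_def q_start by blast+
      then have g: "?g z \<in> F" by (intro limit_in_F)
      then have "(\<lambda>n. dens (run step q z n)) \<longlonglongrightarrow> parity_val (?g z)"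
        unfolding q_start using z val by (intro dens_tendsto_live) auto
      with g show ?thesis by (simp add: density)
    qed
    moreover have "inj_on ?g (Collect live)"
    proof (rule inj_onI)
      fix z z' assume *: "z \<in> Collect live" "z' \<in> Collect live" "?g z = ?g z'"
      have z: "admissible (choices z)" "\<And>i. \<not> z (2 * i)" "admissible (choices z')" "\<And>i. \<not> z' (2 * i)"
        using live_if_not_Dead[of z] live_if_not_Dead[of z'] * unfolding live_def q_start by blast+
      with *(3) have "choices z = choices z'" by (intro limit_inj)
      then have odd: "z (Suc (2 * i)) = z' (Suc (2 * i))" for i by (metis choices_def)
      show "z = z'"
      proof
        fix n show "z n = z' n"
        proof (cases "even n")
          case True
          then obtain i where "n = 2 * i" by blast
          then show ?thesis using z by simp
        next
          case False
          then obtain i where "n = Suc (2 * i)" using oddE by fastforce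
          then show ?thesis using odd by simp
        qed
      qed
    qed
    moreover have "y \<in> ?g ` Collect live" if y: "y \<in> F" for y
    proof -
      obtain w where w: "admissible w" "limit w = y" using limit_surj[OF y] .
      define z where "z n \<longleftrightarrow> odd n \<and> w (n div 2)" for n
      have cz: "choices z = w" by (auto simp: choices_def z_def)
      have even: "run step q z (2 * i) = Adjust (guesses w i) (approx w i) i" for i
        using run_live[of i z] w(1) unfolding cz q_start by (auto simp: z_def admissible_def)
      \<comment> \<open>Death is permanent, but the state is alive at all even times.\<close>
      have "run step q z n \<noteq> Dead a" for n a
      proof
        assume "run step q z n = Dead a"
        then have "\<exists>a. run step q z (n + k) = Dead a" for k by (induction k) auto
        then show False using even[of n] by (metis mult_2 state.distinct(1))
      qed
      then have "live z" by (simp add: live_def)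
      with w(2) cz show ?thesis by auto
    qed
    ultimately show ?thesis by (intro exI[of _ ?g] conjI subsetI) simp_all
  qed
  then obtain g where "(\<forall>z. live z \<longrightarrow> g z \<in> F \<and> density_at (acc q) z (parity_val (g z))) \<and>
      inj_on g (Collect live) \<and> F \<subseteq> g ` Collect live" ..
  then have g: "\<And>z. live z \<Longrightarrow> g z \<in> F" "\<And>z. live z \<Longrightarrow> density_at (acc q) z (parity_val (g z))"
    "inj_on g (Collect live)" "F \<subseteq> g ` Collect live" by simp_all
  have unique: "r = r'" if "density_at (acc q) z r" "density_at (acc q) z r'" for z r r'
    using that LIMSEQ_unique unfolding density by blast
  have dead_only: "r \<in> {0, 1}" if "\<not> live z" "density_at (acc q) z r" for z r
    using dead[OF that(1)] unique[OF that(2)] by blast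
  have live_only: "r = parity_val (g z)" if "live z" "density_at (acc q) z r" for z r
    using unique[OF that(2) g(2)[OF that(1)]] .
  have "solid (acc q)" using dead g(2) unfolding solid_def blurry_def by blast
  moreover have "Rng_inj (acc q)"
    unfolding Rng_inj_def
  proof (intro allI impI, elim conjE)
    fix z z' r assume *: "density_at (acc q) z r" "density_at (acc q) z' r" "r \<in> {0<..<1}"
    have live: "live z" "live z'" using dead_only[of _ r] * by auto
    have "parity_val (g z) = parity_val (g z')"
      using live_only[OF live(1) *(1)] live_only[OF live(2) *(2)] by simp
    then have "g z = g z'" using g(1) live by (auto intro: inj_onD[OF F(3)])
    then show "z = z'" using live by (auto intro: inj_onD[OF g(3)])
  qed
  moreover have "ran_density (acc q) = {0, 1} \<union> B"
  proof -
    have "r \<in> {0, 1} \<union> B" if "density_at (acc q) z r" for z r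
    proof (cases "live z")
      case True
      from live_only[OF this that] g(1)[OF this] show ?thesis using F(2) by blast
    next
      case False
      from dead_only[OF this that] show ?thesis by blast
    qed
    moreover have "\<exists>z. density_at (acc q) z r" if "r \<in> B" for r
    proof -
      have "r \<in> parity_val ` g ` Collect live" using that F(2) g(4) by blast
      then show ?thesis using g(2) by blast
    qed
    moreover have "\<exists>z. density_at (acc q) z r" if "r \<in> {0, 1}" for r
    proof -
      \<comment> \<open>The first target is \<open>1/2\<close>, so for nonempty \<open>F\<close> the
        bit \<open>True\<close> leads to \<open>Dead (1/2)\<close>, and the next bit selects 0 or 1.
        For empty \<open>F\<close> the first bit already does.\<close>
      define z where "z n \<longleftrightarrow> (if F = {} then r = 0 else n = 0 \<or> r = 0)" for n :: nat
      have "dens (run step q z 2) = r"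
      proof (cases "F = {}")
        case True
        then have "q = Dead (1/2)" "z = (\<lambda>_. r = 0)" by (auto simp: q_def z_def)
        then show ?thesis using that by (auto simp: numeral_2_eq_2)
      next
        case False
        then have "q = Adjust (SOME y. y \<in> F, 0, 0) (1/2) 0" "z = (\<lambda>n. n = 0 \<or> r = 0)"
          by (simp_all add: q_def z_def fun_eq_iff)
        then show ?thesis using that by (auto simp: numeral_2_eq_2 target_def approach_def)
      qed
      moreover have "run step q z 2 \<in> Collect valid" using run_closed[OF q] .
      ultimately have "dens (run step q z (n + 2)) = r" for n
        using dens_run_extreme[of "run step q z 2" _ n] run_add[of q z 2 n] that by (simp add: add.commute)
      then have "(\<lambda>n. dens (run step q z (n + 2))) \<longlonglongrightarrow> r" by simp
      then show ?thesis unfolding density by (intro exI[of _ z]) (rule LIMSEQ_offset)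
    qed
    ultimately show ?thesis unfolding ran_density_def by blast
  qed
  ultimately show ?thesis
    using open_accepted[of step dens q] acc_in_sets[of q]
    by (auto simp: cantor_top_eq_euclidean)
qed

lemma dens_seq_Compl:
  assumes "A \<in> sets cantor_measure"
  shows "dens_seq (- A) z n = 1 - dens_seq A z n"
proof -
  interpret prob_space cantor_measure by (rule prob_space_cantor_measure)
  have cyl: "cyl z n \<in> sets cantor_measure"
    by (simp add: sets_cantor_measure open_cyl)
  have "- A \<inter> cyl z n = cyl z n - A \<inter> cyl z n" by auto
  then have "prob (- A \<inter> cyl z n) = prob (cyl z n) - prob (A \<inter> cyl z n)"
    using finite_measure_Diff[OF cyl sets.Int[OF assms cyl]] by simp
  then show ?thesis by (simp add: dens_seq_def measure_cyl left_diff_distrib)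
qed

theorem theorem5p3:
  fixes B :: "real set"
  assumes "B \<in> sets borel" and "B \<subseteq> {0<..<1}"
  shows "(\<exists>A. closedin cantor_top A \<and> A \<in> sets cantor_measure \<and> solid A \<and>
              ran_density A = {0, 1} \<union> B \<and> Rng_inj A)
       \<and> (\<exists>A. openin cantor_top A \<and> A \<in> sets cantor_measure \<and> solid A \<and>
              ran_density A = {0, 1} \<union> B \<and> Rng_inj A)"
proof
  \<comment> \<open>Complements reflect densities, so the open set is built for the reflected
    \<open>B\<close>; reflection preserves Borel sets, the open unit interval and the pair 0,
    1.\<close>
  define B' where "B' = (\<lambda>r. 1 - r) -` B"
  have "(\<lambda>r::real. 1 - r) \<in> borel_measurable borel" by measurable
  from measurable_sets[OF this assms(1)] have "B' \<in> sets borel" by (simp add: B'_def)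
  moreover have "B' \<subseteq> {0<..<1}" using assms(2) by (auto simp: B'_def)
  ultimately obtain A where A: "openin cantor_top A" "A \<in> sets cantor_measure" "solid A"
      "ran_density A = {0, 1} \<union> B'" "Rng_inj A"
    using open_solid_set_exists by blast
  have density: "density_at (- A) z r \<longleftrightarrow> density_at A z (1 - r)" for z r
  proof -
    have "density_at (- A) z r \<longleftrightarrow> (\<lambda>n. 1 - dens_seq A z n) \<longlonglongrightarrow> 1 - (1 - r)"
      unfolding density_at_def using dens_seq_Compl[OF A(2), of z, abs_def] by simp
    also have "\<dots> \<longleftrightarrow> dens_seq A z \<longlonglongrightarrow> 1 - r"
      using tendsto_diff[OF tendsto_const[of 1], of "\<lambda>n. 1 - dens_seq A z n" "1 - (1 - r)" sequentially]
        tendsto_diff[OF tendsto_const[of 1], of "dens_seq A z" "1 - r" sequentially] by auto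
    finally show ?thesis by (simp add: density_at_def)
  qed
  have "closedin cantor_top (- A)"
    using A(1) by (simp add: cantor_top_eq_euclidean closed_def flip: closed_closedin)
  moreover have "- A \<in> sets cantor_measure" using sets.compl_sets[OF A(2)] by (simp add: Compl_eq_Diff_UNIV)
  moreover have "solid (- A)" 
    using A(3) unfolding solid_def blurry_def density by (metis diff_diff_eq2 add_diff_cancel_left')
  moreover have "ran_density (- A) = {0, 1} \<union> B"
  proof -
    have "r \<in> ran_density (- A) \<longleftrightarrow> 1 - r \<in> ran_density A" for r
      by (simp add: ran_density_def density)
    then show ?thesis unfolding A(4) by (auto simp: B'_def)
  qed
  moreover have "Rng_inj (- A)"
    unfolding Rng_inj_def density
  proof (intro allI impI)
    fix z1 z2 r assume "density_at A z1 (1 - r) \<and> density_at A z2 (1 - r) \<and> r \<in> {0<..<1::real}"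
    moreover from this have "1 - r \<in> {0<..<1}" by auto
    ultimately show "z1 = z2" using A(5) unfolding Rng_inj_def by blast
  qed
  ultimately show "\<exists>A. closedin cantor_top A \<and> A \<in> sets cantor_measure \<and> solid A \<and>
      ran_density A = {0, 1} \<union> B \<and> Rng_inj A" by blast
qed (rule open_solid_set_exists[OF assms])

end
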